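(* Let $m>0$ and $a\in\mathbb{R}$ with $a^2>m^2$ (fast Kerr spacetime). (i) Stationary fast Kerr spacetime, i.e. the region where $\beta(r,\theta)=1-\frac{2mr}{r^2+a^2\cos^2\theta}>0$, is not geodesically connected, both if one assumes $r>0$ and if one allows $r\in\mathbb{R}$. (ii) For every $\nu>0$, the region of fast Kerr spacetime determined by $r>\nu$ (whether or not it is stationary) is not geodesically connected. (iii) The whole fast Kerr spacetime (including non-stationary regions and $r\in\mathbb{R}$) is not geodesically connected.
   Context: In Boyer–Lindquist coordinates, $t\in\mathbb{R}$, $r$ is a real coordinate, and $(\theta,\varphi)$ are the usual spherical coordinates (colatitude and longitude) on $S^2$. The Kerr metric with mass $m>0$ and angular momentum $ma$ is $$ds^2=g_{4,4}\,dt^2+g_{1,1}\,dr^2+g_{2,2}\,d\theta^2+g_{3,3}\,d\varphi^2+2g_{3,4}\,dt\,d\varphi,$$ with $\lambda(r,\theta)=r^2+a^2\cos^2\theta$, $\triangle(r)=r^2-2mr+a^2$, and $$g_{1,1}=\frac{\lambda}{\triangle},\quad g_{2,2}=\lambda,\quad g_{3,3}=\Big[r^2+a^2+\frac{2mra^2\sin^2\theta}{\lambda}\Big]\sin^2\theta,\quad g_{3,4}=-\frac{2mra\sin^2\theta}{\lambda},\quad g_{4,4}=-1+\frac{2mr}{\lambda}.$$ When $a^2>m^2$, $\triangle$ has no real zeros, and the metric (extended smoothly across the axis $\theta\in\{0,\pi\}$) is a smooth Lorentz metric on $\{(t,r,(\theta,\varphi))\in\mathbb{R}\times\mathbb{R}\times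 S^2:\lambda(r,\theta)\ne 0\}$, i.e. away from the ring singularity $r=0,\ \theta=\pi/2$; this is the whole fast Kerr spacetime with $r\in\mathbb{R}$. One can also consider only its part $r>0$. The stationary part is the region where $\beta=-g_{4,4}>0$ (within $r>0$, or within $r\in\mathbb{R}$). A spacetime (region) is geodesically connected if any two of its points can be joined by a geodesic (of any causal character) contained in it. *)

theory Defs
  imports "HOL-Analysis.Analysis"
begin

section \<open>Geodesics of a metric tensor, computed in the charts of an atlas\<close>

definition partial_deriv :: "'n \<Rightarrow> (real^'n \<Rightarrow> 'b::real_normed_vector) \<Rightarrow> real^'n \<Rightarrow> 'b" where
  "partial_deriv i f x = vector_derivative (\<lambda>h. f (x + h *\<^sub>R axis i 1)) (at 0)"

definition christoffel :: "(real^'n \<Rightarrow> real^'n^'n) \<Rightarrow> real^'n \<Rightarrow> 'n \<Rightarrow> 'n \<Rightarrow> 'n \<Rightarrow> real" where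
  "christoffel G x k i j =
     (\<Sum>l\<in>UNIV. matrix_inv (G x) $ k $ l *
        (partial_deriv i (\<lambda>y. G y $ j $ l) x
       + partial_deriv j (\<lambda>y. G y $ i $ l) x
       - partial_deriv l (\<lambda>y. G y $ i $ j) x)) / 2"

definition geodesic_equation_on ::
    "(real^'n \<Rightarrow> real^'n^'n) \<Rightarrow> real set \<Rightarrow> (real \<Rightarrow> real^'n) \<Rightarrow> bool" where
  "geodesic_equation_on G J x \<longleftrightarrow>
     (\<exists>v. \<forall>s\<in>J.
        (x has_vector_derivative v s) (at s within J) \<and>
        (v has_vector_derivative
           (\<chi> k. - (\<Sum>i\<in>UNIV. \<Sum>j\<in>UNIV. christoffel G (x s) k i j * v s $ i * v s $ j)))
          (at s within J))"

text \<open>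
  A manifold sits inside a normed space \<open>'p\<close>; a metric tensor is a function
  \<open>g p u v\<close>, of which only the values at tangent vectors \<open>u\<close>, \<open>v\<close> at \<open>p\<close> matter.
  A chart is represented by the pair of its coordinate domain and its parametrization
  (the inverse of the coordinate map), and an atlas by a set of such pairs.
\<close>

type_synonym ('x, 'p) chart = "'x set \<times> ('x \<Rightarrow> 'p)"

definition metric_components ::
    "('p::real_normed_vector \<Rightarrow> 'p \<Rightarrow> 'p \<Rightarrow> real) \<Rightarrow> (real^'n \<Rightarrow> 'p) \<Rightarrow> real^'n \<Rightarrow> real^'n^'n" where
  "metric_components g \<phi> x =
     (\<chi> i j. g (\<phi> x) (partial_deriv i \<phi> x) (partial_deriv j \<phi> x))"

definition is_geodesic ::
    "('p::real_normed_vector \<Rightarrow> 'p \<Rightarrow> 'p \<Rightarrow> real) \<Rightarrow> (real^'n, 'p) chart set \<Rightarrow> (real \<Rightarrow> 'p) \<Rightarrow> bool" where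
  "is_geodesic g \<A> \<gamma> \<longleftrightarrow>
     continuous_on {0..1} \<gamma> \<and>
     (\<forall>(U, \<phi>)\<in>\<A>.
        geodesic_equation_on (metric_components g \<phi>)
          {s\<in>{0..1}. \<gamma> s \<in> \<phi> ` U} (\<lambda>s. the_inv_into U \<phi> (\<gamma> s)))"

definition geodesically_connected ::
    "('p::real_normed_vector \<Rightarrow> 'p \<Rightarrow> 'p \<Rightarrow> real) \<Rightarrow> (real^'n, 'p) chart set \<Rightarrow> 'p set \<Rightarrow> bool" where
  "geodesically_connected g \<A> D \<longleftrightarrow>
     (\<forall>p\<in>D. \<forall>q\<in>D. \<exists>\<gamma>. is_geodesic g \<A> \<gamma> \<and> \<gamma> ` {0..1} \<subseteq> D \<and> \<gamma> 0 = p \<and> \<gamma> 1 = q)"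


section \<open>Kerr spacetime\<close>

definition kerr_lambda :: "real \<Rightarrow> real \<Rightarrow> real \<Rightarrow> real" where
  "kerr_lambda a r \<theta> = r\<^sup>2 + a\<^sup>2 * (cos \<theta>)\<^sup>2"

definition kerr_Delta :: "real \<Rightarrow> real \<Rightarrow> real \<Rightarrow> real" where
  "kerr_Delta m a r = r\<^sup>2 - 2 * m * r + a\<^sup>2"

definition kerr_beta :: "real \<Rightarrow> real \<Rightarrow> real \<Rightarrow> real \<Rightarrow> real" where
  "kerr_beta m a r \<theta> = 1 - 2 * m * r / kerr_lambda a r \<theta>"

text \<open>
  The matrix of the Kerr metric in Boyer--Lindquist coordinates, in the order
  \<open>(r, \<theta>, \<phi>, t)\<close>, so that indices 1, 2, 3, 4 match the subscripts of \<open>g\<^sub>i\<^sub>j\<close>.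
\<close>

definition kerr_BL_matrix :: "real \<Rightarrow> real \<Rightarrow> real \<Rightarrow> real \<Rightarrow> real^4^4" where
  "kerr_BL_matrix m a r \<theta> =
    (let l = kerr_lambda a r \<theta>;
         g11 = l / kerr_Delta m a r;
         g22 = l;
         g33 = (r\<^sup>2 + a\<^sup>2 + 2 * m * r * a\<^sup>2 * (sin \<theta>)\<^sup>2 / l) * (sin \<theta>)\<^sup>2;
         g34 = - (2 * m * r * a * (sin \<theta>)\<^sup>2 / l);
         g44 = - 1 + 2 * m * r / l
     in vector [vector [g11, 0, 0, 0],
                vector [0, g22, 0, 0],
                vector [0, 0, g33, g34],
                vector [0, 0, g34, g44]])"

text \<open>Points are triples \<open>(t, r, n)\<close>, where \<open>n\<close> is a unit vector in three-space.\<close>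

type_synonym point = "real \<times> real \<times> (real^3)"

definition colatitude :: "real^3 \<Rightarrow> real" where
  "colatitude n = arccos (n $ 3)"

definition kerr_spacetime :: "real \<Rightarrow> point set" where
  "kerr_spacetime a = {(t, r, n). norm n = 1 \<and> kerr_lambda a r (colatitude n) \<noteq> 0}"

text \<open>
  The Kerr metric, written so as to make sense on the axis as well.  Off the axis,
  \<open>dn \<bullet> dn = d\<theta>\<^sup>2 + sin\<^sup>2\<theta> d\<phi>\<^sup>2\<close> and \<open>n\<^sub>1 dn\<^sub>2 - n\<^sub>2 dn\<^sub>1 = sin\<^sup>2\<theta> d\<phi>\<close>, which are smooth
  on the whole sphere, as is \<open>cos \<theta> = n\<^sub>3\<close>; moreover
  \<open>g\<^sub>3\<^sub>3 = \<lambda> sin\<^sup>2\<theta> + a\<^sup>2 (1 + 2mr/\<lambda>) sin\<^sup>4\<theta>\<close>, because \<open>r\<^sup>2 + a\<^sup>2 = \<lambda> + a\<^sup>2 sin\<^sup>2\<theta>\<close>.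
  Hence this is the smooth extension across the axis of the tensor given by
  \<open>kerr_BL_matrix\<close>; agreement off the axis is lemma \<open>metric_components_BL\<close> below.
\<close>

definition azimuth_form :: "real^3 \<Rightarrow> real^3 \<Rightarrow> real" where
  "azimuth_form n w = n $ 1 * w $ 2 - n $ 2 * w $ 1"

fun kerr_metric :: "real \<Rightarrow> real \<Rightarrow> point \<Rightarrow> point \<Rightarrow> point \<Rightarrow> real" where
  "kerr_metric m a (t, r, n) (t', r', n') (t'', r'', n'') =
    (let l = kerr_lambda a r (colatitude n);
         \<omega>' = azimuth_form n n';
         \<omega>'' = azimuth_form n n''
     in (- 1 + 2 * m * r / l) * t' * t''
        + l / kerr_Delta m a r * r' * r''
        + l * (n' \<bullet> n'')
        + a\<^sup>2 * (1 + 2 * m * r / l) * \<omega>' * \<omega>''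
        - 2 * m * r * a / l * (t' * \<omega>'' + t'' * \<omega>'))"

text \<open>
  An atlas of the product of \<open>\<real>\<^sup>2\<close> with the sphere: the Boyer--Lindquist charts, with the longitude
  in an arbitrary interval of length \<open>2 * pi\<close>, which cover the complement of the axis, and two
  charts around the half-axes, in which a hemisphere is a graph over the unit disc.
\<close>

definition BL_domain :: "real \<Rightarrow> (real^4) set" where
  "BL_domain \<alpha> = {x. 0 < x $ 2 \<and> x $ 2 < pi \<and> \<alpha> < x $ 3 \<and> x $ 3 < \<alpha> + 2 * pi}"

definition BL_param :: "real^4 \<Rightarrow> point" where
  "BL_param x =
     (x $ 4, x $ 1,
      vector [sin (x $ 2) * cos (x $ 3), sin (x $ 2) * sin (x $ 3), cos (x $ 2)])"

definition polar_domain :: "(real^4) set" where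
  "polar_domain = {x. (x $ 2)\<^sup>2 + (x $ 3)\<^sup>2 < 1}"

definition polar_param :: "real \<Rightarrow> real^4 \<Rightarrow> point" where
  "polar_param \<sigma> x =
     (x $ 4, x $ 1, vector [x $ 2, x $ 3, \<sigma> * sqrt (1 - (x $ 2)\<^sup>2 - (x $ 3)\<^sup>2)])"

definition kerr_atlas :: "(real^4, point) chart set" where
  "kerr_atlas = {(BL_domain \<alpha>, BL_param) | \<alpha>. True}
              \<union> {(polar_domain, polar_param \<sigma>) | \<sigma>. \<sigma> = 1 \<or> \<sigma> = -1}"

text \<open>
  The ring singularity is removed from all regions via \<open>kerr_spacetime\<close>; note that the formula
  for \<open>kerr_beta\<close> would yield the value 1 there.
\<close>

definition kerr_region_above :: "real \<Rightarrow> real \<Rightarrow> point set" where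
  "kerr_region_above a \<nu> = {(t, r, n) \<in> kerr_spacetime a. r > \<nu>}"

definition kerr_stationary :: "real \<Rightarrow> real \<Rightarrow> point set" where
  "kerr_stationary m a = {(t, r, n) \<in> kerr_spacetime a. kerr_beta m a r (colatitude n) > 0}"

abbreviation kerr_geodesically_connected :: "real \<Rightarrow> real \<Rightarrow> point set \<Rightarrow> bool" where
  "kerr_geodesically_connected m a D \<equiv> geodesically_connected (kerr_metric m a) kerr_atlas D"


section \<open>Consistency checks\<close>

lemma vector_4 [simp]:
  "(vector [x, y, z, w] :: 'a::zero^4) $ 1 = x"
  "(vector [x, y, z, w] :: 'a::zero^4) $ 2 = y"
  "(vector [x, y, z, w] :: 'a::zero^4) $ 3 = z"
  "(vector [x, y, z, w] :: 'a::zero^4) $ 4 = w"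
  unfolding vector_def by simp_all

lemma cos_colatitude: "norm n = 1 \<Longrightarrow> cos (colatitude n) = n $ 3"
  unfolding colatitude_def using component_le_norm_cart[of n 3] by (simp add: abs_le_iff)

lemma cos_colatitude_BL: "cos (colatitude (vector [x, y, cos \<theta>])) = cos \<theta>"
  unfolding colatitude_def by simp

lemma has_vector_derivative_vector_3:
  assumes "(f has_real_derivative f') (at s)" "(g has_real_derivative g') (at s)"
    and "(h has_real_derivative h') (at s)"
  shows "((\<lambda>s. vector [f s, g s, h s] :: real^3) has_vector_derivative vector [f', g', h']) (at s)"
proof -
  have eq: "(vector [x, y, z] :: real^3) = x *\<^sub>R axis 1 1 + y *\<^sub>R axis 2 1 + z *\<^sub>R axis 3 1" for x y z
    by (simp add: vec_eq_iff forall_3 axis_def)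
  show ?thesis
    unfolding eq using assms by (auto intro!: derivative_eq_intros)
qed

lemma axis_4 [simp]:
  "axis (i::4) (1::real) $ j = (if i = j then 1 else 0)"
  by (simp add: axis_def)

lemma partial_deriv_BL_param:
  "partial_deriv 1 BL_param x = (0, 1, 0)"
  "partial_deriv 2 BL_param x =
     (0, 0, vector [cos (x $ 2) * cos (x $ 3), cos (x $ 2) * sin (x $ 3), - sin (x $ 2)])"
  "partial_deriv 3 BL_param x =
     (0, 0, vector [- (sin (x $ 2) * sin (x $ 3)), sin (x $ 2) * cos (x $ 3), 0])"
  "partial_deriv 4 BL_param x = (1, 0, 0)"
  unfolding partial_deriv_def BL_param_def
  by (rule vector_derivative_at,
      (intro has_vector_derivative_Pair has_vector_derivative_vector_3;
       auto intro!: derivative_eq_intros has_vector_derivative_vector_3))+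

lemma metric_components_BL:
  "metric_components (kerr_metric m a) BL_param x = kerr_BL_matrix m a (x $ 1) (x $ 2)"
proof -
  define r \<theta> \<psi> where "r = x $ 1" and "\<theta> = x $ 2" and "\<psi> = x $ 3"
  define n :: "real^3" where "n = vector [sin \<theta> * cos \<psi>, sin \<theta> * sin \<psi>, cos \<theta>]"
  define n\<theta> :: "real^3" where "n\<theta> = vector [cos \<theta> * cos \<psi>, cos \<theta> * sin \<psi>, - sin \<theta>]"
  define n\<psi> :: "real^3" where "n\<psi> = vector [- (sin \<theta> * sin \<psi>), sin \<theta> * cos \<psi>, 0]"
  define l where "l = kerr_lambda a r \<theta>"
  have l: "kerr_lambda a r (colatitude n) = l"
    by (simp add: l_def kerr_lambda_def n_def cos_colatitude_BL)
  have ra: "r\<^sup>2 + a\<^sup>2 = l + a\<^sup>2 * (sin \<theta>)\<^sup>2"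
    by (simp add: l_def kerr_lambda_def sin_squared_eq algebra_simps)
  have \<psi>1: "(cos \<psi>)\<^sup>2 = 1 - (sin \<psi>)\<^sup>2" and \<theta>1: "(cos \<theta>)\<^sup>2 = 1 - (sin \<theta>)\<^sup>2"
    by (simp_all add: cos_squared_eq)
  have inner: "n\<theta> \<bullet> n\<theta> = 1" "n\<theta> \<bullet> n\<psi> = 0" "n\<psi> \<bullet> n\<theta> = 0" "n\<psi> \<bullet> n\<psi> = (sin \<theta>)\<^sup>2"
    using \<psi>1 \<theta>1 by (simp_all add: n\<theta>_def n\<psi>_def inner_vec_def sum_3, algebra+)
  have form: "azimuth_form n 0 = 0" "azimuth_form n n\<theta> = 0" "azimuth_form n n\<psi> = (sin \<theta>)\<^sup>2"
    using \<psi>1 by (simp_all add: azimuth_form_def n_def n\<theta>_def n\<psi>_def, algebra+)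
  have B: "BL_param x = (x $ 4, r, n)"
    by (simp add: BL_param_def r_def n_def \<theta>_def \<psi>_def)
  have P: "partial_deriv 1 BL_param x = (0, 1, 0)"
      "partial_deriv 2 BL_param x = (0, 0, n\<theta>)"
      "partial_deriv 3 BL_param x = (0, 0, n\<psi>)"
      "partial_deriv 4 BL_param x = (1, 0, 0)"
    by (simp_all add: partial_deriv_BL_param n\<theta>_def n\<psi>_def \<theta>_def \<psi>_def)
  have g33: "l * (sin \<theta>)\<^sup>2 + a\<^sup>2 * (1 + 2 * m * r / l) * (sin \<theta>)\<^sup>2 * (sin \<theta>)\<^sup>2
      = (r\<^sup>2 + a\<^sup>2 + 2 * m * r * a\<^sup>2 * (sin \<theta>)\<^sup>2 / l) * (sin \<theta>)\<^sup>2"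
    unfolding ra by (simp add: algebra_simps)
  have "metric_components (kerr_metric m a) BL_param x = kerr_BL_matrix m a r \<theta>"
    unfolding vec_eq_iff forall_4 metric_components_def kerr_BL_matrix_def Let_def l_def[symmetric]
    using g33 by (simp add: B P l inner form)
  then show ?thesis by (simp add: r_def \<theta>_def)
qed

lemma kerr_atlas_covers:
  assumes "norm n = 1"
  shows "\<exists>(U, \<phi>)\<in>kerr_atlas. (t, r, n) \<in> \<phi> ` U"
proof -
  have n: "(n $ 1)\<^sup>2 + (n $ 2)\<^sup>2 + (n $ 3)\<^sup>2 = 1"
    using assms by (simp add: norm_eq_1 inner_vec_def sum_3 power2_eq_square)
  show ?thesis
  proof (cases "n $ 3 = 0")
    case True
    then obtain \<psi> where "n $ 1 = cos \<psi>" "n $ 2 = sin \<psi>"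
      using n sincos_total_2pi[of "n $ 1" "n $ 2"] by auto
    then have "(t, r, n) = BL_param (vector [r, pi / 2, \<psi>, t])"
      using True by (simp add: BL_param_def vec_eq_iff forall_3)
    moreover have "vector [r, pi / 2, \<psi>, t] \<in> BL_domain (\<psi> - pi)"
      by (simp add: BL_domain_def)
    ultimately show ?thesis
      unfolding kerr_atlas_def by blast
  next
    case False
    define \<sigma> :: real where "\<sigma> = sgn (n $ 3)"
    have "1 - (n $ 1)\<^sup>2 - (n $ 2)\<^sup>2 = (n $ 3)\<^sup>2"
      using n by simp
    then have "(t, r, n) = polar_param \<sigma> (vector [r, n $ 1, n $ 2, t])"
      by (simp add: polar_param_def vec_eq_iff forall_3 \<sigma>_def sgn_mult_abs)
    moreover have "vector [r, n $ 1, n $ 2, t] \<in> polar_domain"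
      using n False zero_less_power2[of "n $ 3"] unfolding polar_domain_def by (simp, linarith)
    moreover have "\<sigma> = 1 \<or> \<sigma> = -1"
      using False by (simp add: \<sigma>_def sgn_real_def)
    ultimately show ?thesis
      unfolding kerr_atlas_def by blast
  qed
qed

lemma kerr_atlas_inj:
  assumes "(U, \<phi>) \<in> kerr_atlas"
  shows "inj_on \<phi> U"
proof -
  have "inj_on BL_param (BL_domain \<alpha>)" for \<alpha>
  proof (rule inj_onI)
    fix x y
    assume x: "x \<in> BL_domain \<alpha>" and y: "y \<in> BL_domain \<alpha>" and eq: "BL_param x = BL_param y"
    have e: "x $ 4 = y $ 4" "x $ 1 = y $ 1" "cos (x $ 2) = cos (y $ 2)"
        "sin (x $ 2) * cos (x $ 3) = sin (y $ 2) * cos (y $ 3)"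
        "sin (x $ 2) * sin (x $ 3) = sin (y $ 2) * sin (y $ 3)"
      using eq by (simp_all add: BL_param_def vec_eq_iff forall_3)
    have \<theta>: "x $ 2 = y $ 2"
      using e(3) x y cos_inj_pi[of "x $ 2" "y $ 2"] by (simp add: BL_domain_def)
    have "sin (y $ 2) \<noteq> 0"
      using y sin_gt_zero[of "y $ 2"] by (auto simp: BL_domain_def)
    then have "sin (x $ 3) = sin (y $ 3) \<and> cos (x $ 3) = cos (y $ 3)"
      using e \<theta> by simp
    then obtain k :: int where k: "x $ 3 = y $ 3 + 2 * pi * k"
      using sin_cos_eq_iff by blast
    have "\<bar>2 * pi * k\<bar> < 2 * pi * 1"
      using x y k by (auto simp: BL_domain_def)
    then have "\<bar>real_of_int k\<bar> < 1"
      by (simp add: abs_mult)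
    then have "k = 0" by linarith
    then show "x = y"
      using e \<theta> k by (simp add: vec_eq_iff forall_4)
  qed
  moreover have "inj_on (polar_param \<sigma>) polar_domain" for \<sigma>
    by (rule inj_onI) (simp add: polar_param_def vec_eq_iff forall_3 forall_4)
  ultimately show ?thesis
    using assms unfolding kerr_atlas_def by auto
qed

end

theory Submission
  imports Defs
begin

text \<open>
  Take \<open>p\<close> on the axis. The rotational Killing field vanishes there, so every geodesic from \<open>p\<close> has
  zero angular momentum, and then its radial and polar equations separate, with \<open>c = cos \<theta>\<close>:
  \<open>(\<lambda> r')\<^sup>2 = E\<^sup>2 (r\<^sup>2 + a\<^sup>2)\<^sup>2 - \<triangle> (K - C r\<^sup>2)\<close> and
  \<open>(\<lambda> c')\<^sup>2 = (1 - c\<^sup>2) (K - a\<^sup>2 E\<^sup>2 (1 - c\<^sup>2) + a\<^sup>2 C c\<^sup>2)\<close>, where \<open>E\<close> is the energy,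
  \<open>C = g(\<gamma>', \<gamma>')\<close> and \<open>K\<close> is Carter's constant.

  If \<open>p\<close> lies on the northern half-axis with \<open>r > 0\<close> and \<open>q\<close> on the southern one with \<open>r < 0\<close>, a
  connecting geodesic meets \<open>r = 0\<close>, whence \<open>K \<le> a\<^sup>2 E\<^sup>2\<close>, and the equator, whence
  \<open>K \<ge> a\<^sup>2 E\<^sup>2\<close>. With equality the polar equation has a double zero at the equator, which is
  therefore never reached. This settles the regions that allow \<open>r \<in> \<real>\<close>.

  If \<open>r > 0\<close> throughout and \<open>p\<close>, \<open>q\<close> are opposite poles with the same \<open>t\<close> and the same \<open>r\<close>, then
  \<open>E = 0\<close>, since \<open>t'\<close> has the sign of \<open>E\<close>. Then \<open>r\<close> has no interior maximum, so it never exceeds its value at the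
  end points. In the stationary part this contradicts \<open>r > 2 m\<close> at the equator. In the region
  \<open>r > \<nu>\<close> with end points close to \<open>r = \<nu>\<close>, the radial force, bounded away from zero, returns the
  geodesic to its initial radius before it can reach the other pole.
\<close>

section \<open>Geodesics in a chart\<close>

lemma partial_deriv_eq_derivative:
  assumes "(f has_derivative f') (at x)"
  shows "partial_deriv i f x = f' (axis i 1)"
proof -
  have 1: "((\<lambda>h. x + h *\<^sub>R axis i 1) has_vector_derivative axis i 1) (at 0)"
    by (auto intro!: derivative_eq_intros)
  show ?thesis
    unfolding partial_deriv_def
    using vector_derivative_diff_chain_within[OF 1, of f f'] has_derivative_at_withinI[OF assms]
    by (auto simp: o_def intro!: vector_derivative_at)
qed

lemma has_vector_derivative_comp_partial_deriv:
  fixes f :: "real^'n \<Rightarrow> 'b::real_normed_vector"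
  assumes "f differentiable at (x s)" and "(x has_vector_derivative v) (at s within J)"
  shows "((\<lambda>s. f (x s)) has_vector_derivative (\<Sum>k\<in>UNIV. v $ k *\<^sub>R partial_deriv k f (x s))) (at s within J)"
proof -
  obtain f' where f': "(f has_derivative f') (at (x s))"
    using assms(1) by (auto simp: differentiable_def)
  then interpret bounded_linear f' by (rule has_derivative_bounded_linear)
  have "f' v = (\<Sum>k\<in>UNIV. f' (v $ k *\<^sub>R axis k 1))"
    by (metis (no_types, lifting) basis_expansion scalar_mult_eq_scaleR sum sum.cong)
  also have "\<dots> = (\<Sum>k\<in>UNIV. v $ k *\<^sub>R partial_deriv k f (x s))"
    by (simp add: partial_deriv_eq_derivative[OF f'] scaleR)
  moreover have "((f \<circ> x) has_vector_derivative f' v) (at s within J)"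
    using vector_derivative_diff_chain_within[OF assms(2), of f f'] f' has_derivative_at_withinI by blast
  ultimately show ?thesis
    by (simp add: o_def)
qed

lemma matrix_inv_right:
  fixes A :: "real^'n^'n"
  assumes "invertible A"
  shows "A ** matrix_inv A = mat 1"
  using someI_ex[OF assms[unfolded invertible_def]] by (simp add: matrix_inv_def)

section \<open>The geodesic equation in Lagrangian form\<close>

context
  fixes G :: "real^'n \<Rightarrow> real^'n^'n" and J :: "real set" and x v :: "real \<Rightarrow> real^'n" and s :: real
  assumes G_sym: "\<And>y i j. G y $ i $ j = G y $ j $ i"
    and G_inv: "invertible (G (x s))"
    and G_diff: "\<And>i j. (\<lambda>y. G y $ i $ j) differentiable at (x s)"
    and x_deriv: "(x has_vector_derivative v s) (at s within J)"
    and v_deriv: "(v has_vector_derivative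
           (\<chi> k. - (\<Sum>i\<in>UNIV. \<Sum>j\<in>UNIV. christoffel G (x s) k i j * v s $ i * v s $ j)))
          (at s within J)"
begin

private definition D where "D k i j = partial_deriv k (\<lambda>y. G y $ i $ j) (x s)"
private definition w where
  "w k = - (\<Sum>i\<in>UNIV. \<Sum>j\<in>UNIV. christoffel G (x s) k i j * v s $ i * v s $ j)"

private lemma D_sym: "D k i j = D k j i"
  unfolding D_def using G_sym by presburger

private lemma v_comp: "((\<lambda>s. v s $ j) has_real_derivative w j) (at s within J)"
proof -
  have "((\<lambda>s. v s $ j) has_vector_derivative
      (\<chi> k. - (\<Sum>i\<in>UNIV. \<Sum>j\<in>UNIV. christoffel G (x s) k i j * v s $ i * v s $ j)) $ j) (at s within J)"
    by (rule bounded_linear.has_vector_derivative[OF bounded_linear_vec_nth v_deriv])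
  then show ?thesis
    by (simp add: has_real_derivative_iff_has_vector_derivative w_def)
qed

private lemma G_comp:
  "((\<lambda>s. G (x s) $ i $ j) has_real_derivative (\<Sum>k\<in>UNIV. D k i j * v s $ k)) (at s within J)"
  using has_vector_derivative_comp_partial_deriv[OF G_diff x_deriv]
  by (simp add: D_def has_real_derivative_iff_has_vector_derivative mult.commute)

text \<open>Lowering the first index cancels the inverse matrix and leaves the Christoffel symbols
  of the first kind. Invertibility of \<open>G\<close> enters the context only here.\<close>

private lemma lower_christoffel:
  "(\<Sum>k\<in>UNIV. G (x s) $ l $ k * christoffel G (x s) k i j) = (D i j l + D j i l - D l i j) / 2"
proof -
  have inv: "(\<Sum>k\<in>UNIV. G (x s) $ l $ k * matrix_inv (G (x s)) $ k $ q) = (if l = q then 1 else 0)" for q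
    using matrix_inv_right[OF G_inv] by (simp add: vec_eq_iff matrix_matrix_mult_def mat_def)
  have "(\<Sum>k\<in>UNIV. G (x s) $ l $ k * christoffel G (x s) k i j)
      = (\<Sum>k\<in>UNIV. \<Sum>q\<in>UNIV. G (x s) $ l $ k * matrix_inv (G (x s)) $ k $ q * (D i j q + D j i q - D q i j)) / 2"
    unfolding christoffel_def D_def by (simp add: sum_distrib_left sum_divide_distrib mult.assoc)
  also have "\<dots> = (\<Sum>q\<in>UNIV. (\<Sum>k\<in>UNIV. G (x s) $ l $ k * matrix_inv (G (x s)) $ k $ q) * (D i j q + D j i q - D q i j)) / 2"
    by (subst sum.swap) (simp add: sum_distrib_right)
  also have "\<dots> = (D i j l + D j i l - D l i j) / 2"
    unfolding inv by (simp add: if_distrib[of "\<lambda>t. t * _"] cong: if_cong)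
  finally show ?thesis .
qed

text \<open>Of the three terms of a Christoffel symbol, the two with positive sign coincide after an
  exchange of summation indices, so together they lose the factor 1/2.\<close>

private lemma lower_acceleration:
  "(\<Sum>k\<in>UNIV. G (x s) $ l $ k * w k)
    = (\<Sum>i\<in>UNIV. \<Sum>j\<in>UNIV. D l i j * v s $ i * v s $ j) / 2
      - (\<Sum>i\<in>UNIV. \<Sum>j\<in>UNIV. D i l j * v s $ i * v s $ j)"
proof -
  have "(\<Sum>k\<in>UNIV. G (x s) $ l $ k * w k)
     = - (\<Sum>k\<in>UNIV. \<Sum>i\<in>UNIV. \<Sum>j\<in>UNIV. G (x s) $ l $ k * christoffel G (x s) k i j * v s $ i * v s $ j)"
    unfolding w_def by (simp add: sum_distrib_left sum_negf mult.assoc)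
  also have "\<dots> = - (\<Sum>i\<in>UNIV. \<Sum>k\<in>UNIV. \<Sum>j\<in>UNIV. G (x s) $ l $ k * christoffel G (x s) k i j * v s $ i * v s $ j)"
    by (subst sum.swap) simp
  also have "\<dots> = - (\<Sum>i\<in>UNIV. \<Sum>j\<in>UNIV. \<Sum>k\<in>UNIV. G (x s) $ l $ k * christoffel G (x s) k i j * v s $ i * v s $ j)"
    by (intro arg_cong[where f=uminus] sum.cong refl sum.swap)
  also have "\<dots> = - (\<Sum>i\<in>UNIV. \<Sum>j\<in>UNIV. (D i j l + D j i l - D l i j) / 2 * v s $ i * v s $ j)"
    by (simp only: lower_christoffel[symmetric] sum_distrib_right)
  also have "\<dots> = (\<Sum>i\<in>UNIV. \<Sum>j\<in>UNIV. D l i j * v s $ i * v s $ j) / 2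
      - (\<Sum>i\<in>UNIV. \<Sum>j\<in>UNIV. D i j l * v s $ i * v s $ j) / 2
      - (\<Sum>i\<in>UNIV. \<Sum>j\<in>UNIV. D j i l * v s $ i * v s $ j) / 2"
    unfolding sum_divide_distrib sum_negf[symmetric] sum_subtractf[symmetric]
    by (intro sum.cong refl) (simp add: field_simps)
  also have "(\<Sum>i\<in>UNIV. \<Sum>j\<in>UNIV. D j i l * v s $ i * v s $ j) = (\<Sum>i\<in>UNIV. \<Sum>j\<in>UNIV. D i j l * v s $ i * v s $ j)"
    by (subst sum.swap) (simp add: mult_ac)
  finally show ?thesis by (simp add: D_sym[of _ _ l])
qed

text \<open>Euler-Lagrange form: the derivative of the metric along the curve cancels against the
  second sum in \<open>lower_acceleration\<close>, and only the derivative in direction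
  \<open>l\<close> survives. A coordinate on which the metric does not depend thus has a conserved
  momentum.\<close>

lemma geodesic_momentum:
  "((\<lambda>s. \<Sum>j\<in>UNIV. G (x s) $ l $ j * v s $ j) has_real_derivative
     (\<Sum>i\<in>UNIV. \<Sum>j\<in>UNIV. partial_deriv l (\<lambda>y. G y $ i $ j) (x s) * v s $ i * v s $ j) / 2)
   (at s within J)"
proof -
  have "((\<lambda>s. \<Sum>j\<in>UNIV. G (x s) $ l $ j * v s $ j) has_real_derivative
     (\<Sum>j\<in>UNIV. (\<Sum>k\<in>UNIV. D k l j * v s $ k) * v s $ j + w j * G (x s) $ l $ j)) (at s within J)"
    by (intro DERIV_sum DERIV_mult v_comp G_comp)
  also have "(\<Sum>j\<in>UNIV. (\<Sum>k\<in>UNIV. D k l j * v s $ k) * v s $ j + w j * G (x s) $ l $ j)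
     = (\<Sum>j\<in>UNIV. \<Sum>k\<in>UNIV. D k l j * v s $ k * v s $ j) + (\<Sum>k\<in>UNIV. G (x s) $ l $ k * w k)"
    by (simp add: sum.distrib sum_distrib_left sum_distrib_right mult_ac)
  also have "(\<Sum>j\<in>UNIV. \<Sum>k\<in>UNIV. D k l j * v s $ k * v s $ j) = (\<Sum>i\<in>UNIV. \<Sum>j\<in>UNIV. D i l j * v s $ i * v s $ j)"
    by (rule sum.swap)
  finally show ?thesis
    unfolding lower_acceleration D_def by simp
qed

text \<open>The cubic sum \<open>?T\<close> enters with weight 1/2 from the derivatives of the
  momenta and with weight 1/2 - 1 from the acceleration.\<close>

lemma geodesic_energy:
  "((\<lambda>s. \<Sum>i\<in>UNIV. (\<Sum>j\<in>UNIV. G (x s) $ i $ j * v s $ j) * v s $ i) has_real_derivative 0) (at s within J)"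
proof -
  let ?T = "\<Sum>i\<in>UNIV. \<Sum>j\<in>UNIV. \<Sum>k\<in>UNIV. D i j k * v s $ i * v s $ j * v s $ k"
  have "(\<Sum>i\<in>UNIV. (\<Sum>j\<in>UNIV. G (x s) $ i $ j * v s $ j) * w i)
      = (\<Sum>i\<in>UNIV. \<Sum>j\<in>UNIV. G (x s) $ i $ j * w i * v s $ j)"
    by (simp add: sum_distrib_right sum_distrib_left mult_ac)
  also have "\<dots> = (\<Sum>j\<in>UNIV. \<Sum>i\<in>UNIV. G (x s) $ j $ i * w i * v s $ j)"
    by (subst sum.swap) (simp add: G_sym)
  also have "\<dots> = (\<Sum>l\<in>UNIV. (\<Sum>k\<in>UNIV. G (x s) $ l $ k * w k) * v s $ l)"
    by (simp add: sum_distrib_right)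
  also have "\<dots> = ?T / 2 - (\<Sum>l\<in>UNIV. \<Sum>i\<in>UNIV. \<Sum>j\<in>UNIV. D i l j * v s $ i * v s $ l * v s $ j)"
    unfolding lower_acceleration
    by (simp add: sum_subtractf sum_distrib_left sum_distrib_right sum_divide_distrib right_diff_distrib mult_ac)
  also have "(\<Sum>l\<in>UNIV. \<Sum>i\<in>UNIV. \<Sum>j\<in>UNIV. D i l j * v s $ i * v s $ l * v s $ j) = ?T"
    by (rule sum.swap)
  finally have *: "(\<Sum>i\<in>UNIV. (\<Sum>j\<in>UNIV. G (x s) $ i $ j * v s $ j) * w i) = - ?T / 2" by simp
  have "((\<lambda>s. \<Sum>i\<in>UNIV. (\<Sum>j\<in>UNIV. G (x s) $ i $ j * v s $ j) * v s $ i) has_real_derivative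
     (\<Sum>i\<in>UNIV. (\<Sum>j\<in>UNIV. \<Sum>k\<in>UNIV. D i j k * v s $ j * v s $ k) / 2 * v s $ i
        + w i * (\<Sum>j\<in>UNIV. G (x s) $ i $ j * v s $ j))) (at s within J)"
    unfolding D_def by (intro DERIV_sum DERIV_mult v_comp geodesic_momentum)
  also have "(\<Sum>i\<in>UNIV. (\<Sum>j\<in>UNIV. \<Sum>k\<in>UNIV. D i j k * v s $ j * v s $ k) / 2 * v s $ i
        + w i * (\<Sum>j\<in>UNIV. G (x s) $ i $ j * v s $ j))
      = ?T / 2 + (\<Sum>i\<in>UNIV. (\<Sum>j\<in>UNIV. G (x s) $ i $ j * v s $ j) * w i)"
    by (simp add: sum.distrib sum_distrib_left sum_distrib_right sum_divide_distrib mult_ac)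
  finally show ?thesis unfolding * by simp
qed

end

text \<open>\<open>is_geodesic\<close> differentiates within the set of times spent in the chart. To
  replace that set by \<open>{0..1}\<close>, it must contain a relative neighbourhood of
  \<open>s0\<close>. The image of a chart need not be open in the ambient space, so an open set
  \<open>V\<close> that detects membership along the curve is taken as a hypothesis.\<close>

lemma geodesic_in_chart:
  assumes "is_geodesic g \<A> \<gamma>" "(U, \<phi>) \<in> \<A>" "inj_on \<phi> U" and s0: "s0 \<in> {0..1}"
    and V: "open V" "\<gamma> s0 \<in> V" "\<And>s. s \<in> {0..1} \<Longrightarrow> \<gamma> s \<in> V \<Longrightarrow> \<gamma> s \<in> \<phi> ` U"
  obtains x v e where "e > 0"
    "\<And>s. s \<in> {0..1} \<Longrightarrow> dist s s0 < e \<Longrightarrow> x s \<in> U \<and> \<phi> (x s) = \<gamma> s \<and>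
      (x has_vector_derivative v s) (at s within {0..1}) \<and>
      (v has_vector_derivative (\<chi> k. - (\<Sum>i\<in>UNIV. \<Sum>j\<in>UNIV.
          christoffel (metric_components g \<phi>) (x s) k i j * v s $ i * v s $ j))) (at s within {0..1})"
proof -
  define J where "J = {s\<in>{0..1}. \<gamma> s \<in> \<phi> ` U}"
  define x where "x s = the_inv_into U \<phi> (\<gamma> s)" for s
  have "geodesic_equation_on (metric_components g \<phi>) J x"
    using assms(1,2) unfolding is_geodesic_def J_def x_def by fast
  then obtain v where v: "\<And>s. s \<in> J \<Longrightarrow> (x has_vector_derivative v s) (at s within J)"
     "\<And>s. s \<in> J \<Longrightarrow> (v has_vector_derivative (\<chi> k. - (\<Sum>i\<in>UNIV. \<Sum>j\<in>UNIV.
          christoffel (metric_components g \<phi>) (x s) k i j * v s $ i * v s $ j))) (at s within J)"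
    unfolding geodesic_equation_on_def by blast
  have cont: "continuous_on {0..1} \<gamma>" using assms(1) by (simp add: is_geodesic_def)
  obtain d where d: "d > 0" "ball (\<gamma> s0) d \<subseteq> V" using V(1,2) openE by blast
  obtain e where e: "e > 0" "\<And>s. s \<in> {0..1} \<Longrightarrow> dist s s0 < e \<Longrightarrow> dist (\<gamma> s) (\<gamma> s0) < d"
    using cont s0 d(1) unfolding continuous_on_iff by metis
  have J: "s \<in> J" if "s \<in> {0..1}" "dist s s0 < e" for s
  proof -
    have "\<gamma> s \<in> ball (\<gamma> s0) d" using e(2)[OF that] by (simp add: dist_commute)
    then show ?thesis using d(2) V(3)[OF that(1)] that(1) by (auto simp: J_def)
  qed
  have within: "at s within J = at s within {0..1}" if "s \<in> {0..1}" "dist s s0 < e" for s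
  proof (rule at_within_nhd[of s "ball s0 e"])
    show "J \<inter> ball s0 e - {s} = {0..1} \<inter> ball s0 e - {s}"
      using J by (auto simp: J_def dist_commute)
  qed (use that in \<open>auto simp: dist_commute\<close>)
  show thesis
  proof
    show "e > 0" by fact
    fix s :: real assume s: "s \<in> {0..1}" "dist s s0 < e"
    have "x s \<in> U \<and> \<phi> (x s) = \<gamma> s"
      using J[OF s] assms(3) by (auto simp: J_def x_def the_inv_into_f_f)
    then show "x s \<in> U \<and> \<phi> (x s) = \<gamma> s \<and>
      (x has_vector_derivative v s) (at s within {0..1}) \<and>
      (v has_vector_derivative (\<chi> k. - (\<Sum>i\<in>UNIV. \<Sum>j\<in>UNIV.
          christoffel (metric_components g \<phi>) (x s) k i j * v s $ i * v s $ j))) (at s within {0..1})"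
      using v[OF J[OF s]] unfolding within[OF s] by blast
  qed
qed

lemma metric_components_vec_mult:
  assumes "bilinear (g (\<phi> x))"
  shows "(\<Sum>j\<in>UNIV. metric_components g \<phi> x $ i $ j * v $ j)
    = g (\<phi> x) (partial_deriv i \<phi> x) (\<Sum>j\<in>UNIV. v $ j *\<^sub>R partial_deriv j \<phi> x)"
proof -
  have "linear (g (\<phi> x) (partial_deriv i \<phi> x))" using assms by (simp add: bilinear_def)
  then show ?thesis
    by (simp add: metric_components_def linear_sum linear_scale mult.commute)
qed

text \<open>Momenta are expressed through the ambient velocity, so that laws found in different
  charts can be compared. Regularity of the metric is demanded only over the point
  \<open>\<gamma> s0\<close>, where the laws are concluded; this allows a chart to be examined at a
  single point, such as a pole.\<close>

lemma geodesic_laws_in_chart: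
  assumes "is_geodesic g \<A> \<gamma>" "(U, \<phi>) \<in> \<A>" "inj_on \<phi> U" and s0: "s0 \<in> {0..1}"
    and "open V" "\<gamma> s0 \<in> V" "\<And>s. s \<in> {0..1} \<Longrightarrow> \<gamma> s \<in> V \<Longrightarrow> \<gamma> s \<in> \<phi> ` U"
    and bil: "\<And>p. bilinear (g p)" and sym: "\<And>p u w. g p u w = g p w u"
    and \<phi>_diff: "\<And>y. y \<in> U \<Longrightarrow> \<phi> differentiable at y"
    and inv: "\<And>y. y \<in> U \<Longrightarrow> \<phi> y = \<gamma> s0 \<Longrightarrow> invertible (metric_components g \<phi> y)"
    and G_diff: "\<And>y i j. y \<in> U \<Longrightarrow> \<phi> y = \<gamma> s0 \<Longrightarrow>
      (\<lambda>z. metric_components g \<phi> z $ i $ j) differentiable at y"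
  defines "\<gamma>' \<equiv> \<lambda>s. vector_derivative \<gamma> (at s within {0..1})"
  obtains x v e where "e > 0"
    "\<And>s. s \<in> {0..1} \<Longrightarrow> dist s s0 < e \<Longrightarrow> x s \<in> U \<and> \<phi> (x s) = \<gamma> s"
    "\<And>s. s \<in> {0..1} \<Longrightarrow> dist s s0 < e \<Longrightarrow> (x has_vector_derivative v s) (at s within {0..1})"
    "\<gamma>' s0 = (\<Sum>k\<in>UNIV. v s0 $ k *\<^sub>R partial_deriv k \<phi> (x s0))"
    "(\<gamma> has_vector_derivative \<gamma>' s0) (at s0 within {0..1})"
    "\<And>l. ((\<lambda>s. g (\<gamma> s) (partial_deriv l \<phi> (x s)) (\<gamma>' s)) has_real_derivative
       (\<Sum>i\<in>UNIV. \<Sum>j\<in>UNIV. partial_deriv l (\<lambda>y. metric_components g \<phi> y $ i $ j) (x s0) * v s0 $ i * v s0 $ j) / 2)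
         (at s0 within {0..1})"
    "((\<lambda>s. g (\<gamma> s) (\<gamma>' s) (\<gamma>' s)) has_real_derivative 0) (at s0 within {0..1})"
proof -
  let ?G = "metric_components g \<phi>"
  obtain x v e where e: "e > 0"
    and xv: "\<And>s. s \<in> {0..1} \<Longrightarrow> dist s s0 < e \<Longrightarrow> x s \<in> U \<and> \<phi> (x s) = \<gamma> s \<and>
      (x has_vector_derivative v s) (at s within {0..1}) \<and>
      (v has_vector_derivative (\<chi> k. - (\<Sum>i\<in>UNIV. \<Sum>j\<in>UNIV.
          christoffel ?G (x s) k i j * v s $ i * v s $ j))) (at s within {0..1})"
    by (rule geodesic_in_chart[OF assms(1-7)]) blast+
  have \<gamma>_deriv: "(\<gamma> has_vector_derivative (\<Sum>k\<in>UNIV. v s $ k *\<^sub>R partial_deriv k \<phi> (x s))) (at s within {0..1})"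
    if s: "s \<in> {0..1}" "dist s s0 < e" for s
  proof (rule has_vector_derivative_transform_within)
    show "((\<lambda>s. \<phi> (x s)) has_vector_derivative (\<Sum>k\<in>UNIV. v s $ k *\<^sub>R partial_deriv k \<phi> (x s))) (at s within {0..1})"
      using xv[OF s] \<phi>_diff by (intro has_vector_derivative_comp_partial_deriv) auto
    show "0 < e - dist s s0" using s by simp
    show "\<phi> (x s') = \<gamma> s'" if "s' \<in> {0..1}" "dist s' s < e - dist s s0" for s'
    proof -
      have "dist s' s0 < e" using dist_triangle[of s' s0 s] that by linarith
      then show ?thesis using xv that by blast
    qed
  qed (use s in auto)
  have \<gamma>': "\<gamma>' s = (\<Sum>k\<in>UNIV. v s $ k *\<^sub>R partial_deriv k \<phi> (x s))" if "s \<in> {0..1}" "dist s s0 < e" for s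
    unfolding \<gamma>'_def by (rule vector_derivative_within_cbox[of 0 1, simplified]) (use that \<gamma>_deriv in auto)
  have s0': "dist s0 s0 < e" using e by simp
  note xv0 = xv[OF s0 s0']
  have G_sym: "?G y $ i $ j = ?G y $ j $ i" for y i j
    by (simp add: metric_components_def sym)
  have mom: "(\<Sum>j\<in>UNIV. ?G (x s) $ l $ j * v s $ j) = g (\<gamma> s) (partial_deriv l \<phi> (x s)) (\<gamma>' s)"
    if "s \<in> {0..1}" "dist s s0 < e" for s l
    using metric_components_vec_mult[of g \<phi> "x s" l "v s", OF bil] xv[OF that] \<gamma>'[OF that] by simp
  have energy: "(\<Sum>i\<in>UNIV. (\<Sum>j\<in>UNIV. ?G (x s) $ i $ j * v s $ j) * v s $ i) = g (\<gamma> s) (\<gamma>' s) (\<gamma>' s)"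
    if s: "s \<in> {0..1}" "dist s s0 < e" for s
  proof -
    have lin: "linear (\<lambda>u. g (\<gamma> s) u (\<gamma>' s))" using bil by (simp add: bilinear_def)
    then have "g (\<gamma> s) (\<Sum>k\<in>UNIV. v s $ k *\<^sub>R partial_deriv k \<phi> (x s)) (\<gamma>' s)
        = (\<Sum>k\<in>UNIV. v s $ k * g (\<gamma> s) (partial_deriv k \<phi> (x s)) (\<gamma>' s))"
      by (simp add: linear_sum[OF lin] linear_scale[OF lin])
    then show ?thesis unfolding mom[OF s] \<gamma>'[OF s, symmetric] by (simp add: mult.commute)
  qed
  note inv0 = inv[OF conjunct1[OF xv0] conjunct1[OF conjunct2[OF xv0]]]
  note G_diff0 = G_diff[OF conjunct1[OF xv0] conjunct1[OF conjunct2[OF xv0]]]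
  note x0 = conjunct1[OF conjunct2[OF conjunct2[OF xv0]]]
  note v0 = conjunct2[OF conjunct2[OF conjunct2[OF xv0]]]
  show thesis
  proof (rule that[OF e])
    show "((\<lambda>s. g (\<gamma> s) (partial_deriv l \<phi> (x s)) (\<gamma>' s)) has_real_derivative
       (\<Sum>i\<in>UNIV. \<Sum>j\<in>UNIV. partial_deriv l (\<lambda>y. ?G y $ i $ j) (x s0) * v s0 $ i * v s0 $ j) / 2)
         (at s0 within {0..1})" for l
      by (rule has_field_derivative_transform_within[OF geodesic_momentum[OF G_sym inv0 G_diff0 x0 v0] e s0 mom])
    show "((\<lambda>s. g (\<gamma> s) (\<gamma>' s) (\<gamma>' s)) has_real_derivative 0) (at s0 within {0..1})"
      by (rule has_field_derivative_transform_within[OF geodesic_energy[OF G_sym inv0 G_diff0 x0 v0] e s0 energy])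
  qed (use xv \<gamma>'[OF s0 s0'] \<gamma>_deriv[OF s0 s0'] in auto)
qed

section \<open>The Kerr metric as a bilinear form\<close>

lemma kerr_Delta_eq: "kerr_Delta m a r = (r - m)\<^sup>2 + (a\<^sup>2 - m\<^sup>2)"
  by (simp add: kerr_Delta_def power2_diff algebra_simps)

lemma kerr_Delta_pos: "m\<^sup>2 < a\<^sup>2 \<Longrightarrow> kerr_Delta m a r > 0"
  unfolding kerr_Delta_eq by (smt (verit) zero_le_power2)

lemma partial_deriv_const_along:
  fixes f :: "real^'n \<Rightarrow> 'b::real_normed_vector"
  assumes "\<forall>h. f (x + h *\<^sub>R axis i 1) = f x"
  shows "partial_deriv i f x = 0"
  using assms by (simp add: partial_deriv_def)
text \<open>All contributions of 2mr/\<lambda> combine into the square of the one-form dt - a sin^2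
  \<theta> d\<phi>. The radius then enters only through the coefficients 2mr/\<lambda>,
  \<lambda>/\<triangle> and \<lambda>, and the colatitude only through \<open>n $ 3\<close>, which
  is smooth at the poles whereas arccos is not.\<close>

lemma kerr_metric_dragging_form:
  assumes "norm n = 1"
  shows "kerr_metric m a (t, r, n) (t1, r1, n1) (t2, r2, n2) =
    - t1 * t2 + a\<^sup>2 * azimuth_form n n1 * azimuth_form n n2
    + 2 * m * r / (r\<^sup>2 + a\<^sup>2 * (n $ 3)\<^sup>2) * (t1 - a * azimuth_form n n1) * (t2 - a * azimuth_form n n2)
    + (r\<^sup>2 + a\<^sup>2 * (n $ 3)\<^sup>2) / kerr_Delta m a r * r1 * r2
    + (r\<^sup>2 + a\<^sup>2 * (n $ 3)\<^sup>2) * (n1 \<bullet> n2)"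
proof -
  have l: "kerr_lambda a r (colatitude n) = r\<^sup>2 + a\<^sup>2 * (n $ 3)\<^sup>2"
    by (simp add: kerr_lambda_def cos_colatitude[OF assms])
  have ring: "(- 1 + k) * t1 * t2 + z * r1 * r2 + b * w + a\<^sup>2 * (1 + k) * x1 * x2 - k * a * (t1 * x2 + t2 * x1)
    = - t1 * t2 + a\<^sup>2 * x1 * x2 + k * (t1 - a * x1) * (t2 - a * x2) + z * r1 * r2 + b * w"
    for k z b w x1 x2 by algebra
  show ?thesis
    unfolding kerr_metric.simps Let_def l times_divide_eq_left[symmetric] by (rule ring)
qed

lemma linear_azimuth_form: "linear (azimuth_form n)"
  by (rule linearI) (simp_all add: azimuth_form_def algebra_simps)

text \<open>Common shape of the Kerr metric and of its radial derivative at a point, so that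
  bilinearity has to be proved only once.\<close>

definition axial_form :: "real \<Rightarrow> real \<Rightarrow> real \<Rightarrow> real \<Rightarrow> real \<Rightarrow> real^3 \<Rightarrow> point \<Rightarrow> point \<Rightarrow> real" where
  "axial_form P Q X Z W n = (\<lambda>(t1, r1, n1) (t2, r2, n2).
     P * t1 * t2 + Z * r1 * r2 + W * (n1 \<bullet> n2) + X * azimuth_form n n1 * azimuth_form n n2
       - Q * (t1 * azimuth_form n n2 + t2 * azimuth_form n n1))"

lemma axial_form_sym: "axial_form P Q X Z W n u w = axial_form P Q X Z W n w u"
  by (cases u; cases w) (simp add: axial_form_def inner_commute)

lemma bilinear_axial_form: "bilinear (axial_form P Q X Z W n)"
proof -
  have "linear (axial_form P Q X Z W n u)" for u
    unfolding axial_form_def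
    by (cases u, rule linearI)
      (auto simp: linear_add[OF linear_azimuth_form] linear_scale[OF linear_azimuth_form]
        inner_add_right algebra_simps)
  then show ?thesis
    by (simp add: bilinear_def axial_form_sym[of P Q X Z W n _ w for w] eta_contract_eq)
qed

lemma kerr_metric_eq_axial_form:
  "kerr_metric m a (t, r, n) =
    (let l = kerr_lambda a r (colatitude n) in
     axial_form (- 1 + 2 * m * r / l) (2 * m * r * a / l) (a\<^sup>2 * (1 + 2 * m * r / l)) (l / kerr_Delta m a r) l n)"
  by (intro ext) (simp only: split_paired_all kerr_metric.simps axial_form_def Let_def prod.case)

lemma kerr_metric_sym: "kerr_metric m a p u w = kerr_metric m a p w u"
  by (cases p) (simp only: kerr_metric_eq_axial_form Let_def axial_form_sym[of _ _ _ _ _ _ u])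

lemma bilinear_kerr_metric: "bilinear (kerr_metric m a p)"
  by (cases p) (simp only: kerr_metric_eq_axial_form Let_def bilinear_axial_form)

text \<open>The radial derivative of the metric with the tangent vectors held fixed, obtained by
  differentiating the coefficients of the dragging form. It is the source term of the radial
  geodesic equation.\<close>

fun kerr_metric_dr :: "real \<Rightarrow> real \<Rightarrow> point \<Rightarrow> point \<Rightarrow> point \<Rightarrow> real" where
  "kerr_metric_dr m a (t, r, n) (t1, r1, n1) (t2, r2, n2) =
    (let l = r\<^sup>2 + a\<^sup>2 * (n $ 3)\<^sup>2; D = kerr_Delta m a r in
     2 * m * (l - 2 * r\<^sup>2) / l\<^sup>2 * (t1 - a * azimuth_form n n1) * (t2 - a * azimuth_form n n2)
     + (2 * r / D - 2 * (r - m) * l / D\<^sup>2) * r1 * r2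
     + 2 * r * (n1 \<bullet> n2))"

lemma bilinear_kerr_metric_dr: "bilinear (kerr_metric_dr m a p)"
proof (cases p)
  case (fields t r n)
  define l where "l = r\<^sup>2 + a\<^sup>2 * (n $ 3)\<^sup>2"
  define k where "k = 2 * m * (l - 2 * r\<^sup>2) / l\<^sup>2"
  define z where "z = 2 * r / kerr_Delta m a r - 2 * (r - m) * l / (kerr_Delta m a r)\<^sup>2"
  have ring: "k * (t1 - a * x1) * (t2 - a * x2) + z * r1 * r2 + 2 * r * w =
      k * t1 * t2 + z * r1 * r2 + 2 * r * w + k * a\<^sup>2 * x1 * x2 - k * a * (t1 * x2 + t2 * x1)"
    for t1 t2 x1 x2 r1 r2 w by algebra
  have "kerr_metric_dr m a p = axial_form k (k * a) (k * a\<^sup>2) z (2 * r) n"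
  proof (intro ext)
    fix u w
    show "kerr_metric_dr m a p u w = axial_form k (k * a) (k * a\<^sup>2) z (2 * r) n u w"
      unfolding fields
      by (cases u; cases w; simp only: kerr_metric_dr.simps axial_form_def Let_def prod.case
        l_def[symmetric] k_def[symmetric] z_def[symmetric]) (rule ring)
  qed
  then show ?thesis by (simp only: bilinear_axial_form)
qed

lemma kerr_metric_coeff_r_deriv:
  fixes r q m a :: real
  shows "r\<^sup>2 + q \<noteq> 0 \<Longrightarrow> ((\<lambda>x. 2 * m * x / (x\<^sup>2 + q)) has_real_derivative 2 * m * (r\<^sup>2 + q - 2 * r\<^sup>2) / (r\<^sup>2 + q)\<^sup>2) (at r)"
    and "kerr_Delta m a r \<noteq> 0 \<Longrightarrow> ((\<lambda>x. (x\<^sup>2 + q) / kerr_Delta m a x) has_real_derivative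
      2 * r / kerr_Delta m a r - 2 * (r - m) * (r\<^sup>2 + q) / (kerr_Delta m a r)\<^sup>2) (at r)"
proof -
  have l: "((\<lambda>x. x\<^sup>2 + q) has_real_derivative 2 * r) (at r)"
    by (auto intro!: derivative_eq_intros)
  have D: "(kerr_Delta m a has_real_derivative 2 * (r - m)) (at r)"
    unfolding kerr_Delta_def[abs_def] by (auto intro!: derivative_eq_intros)
  show "((\<lambda>x. 2 * m * x / (x\<^sup>2 + q)) has_real_derivative 2 * m * (r\<^sup>2 + q - 2 * r\<^sup>2) / (r\<^sup>2 + q)\<^sup>2) (at r)"
    if nz: "r\<^sup>2 + q \<noteq> 0"
  proof (rule DERIV_cong[OF DERIV_divide[OF _ l nz]])
    show "((\<lambda>x. 2 * m * x) has_real_derivative 2 * m) (at r)"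
      by (auto intro!: derivative_eq_intros)
  qed (simp add: power2_eq_square algebra_simps)
  show "((\<lambda>x. (x\<^sup>2 + q) / kerr_Delta m a x) has_real_derivative
      2 * r / kerr_Delta m a r - 2 * (r - m) * (r\<^sup>2 + q) / (kerr_Delta m a r)\<^sup>2) (at r)"
    if nz: "kerr_Delta m a r \<noteq> 0"
    by (rule DERIV_cong[OF DERIV_divide[OF l D nz]])
       (use nz in \<open>simp add: power2_eq_square diff_divide_distrib mult.commute\<close>)
qed

lemma kerr_metric_r_deriv:
  assumes "norm n = 1" "r\<^sup>2 + a\<^sup>2 * (n $ 3)\<^sup>2 \<noteq> 0" "kerr_Delta m a r \<noteq> 0"
  shows "((\<lambda>x. kerr_metric m a (t, x, n) u w) has_real_derivative kerr_metric_dr m a (t, r, n) u w) (at r)"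
proof (cases u, cases w)
  fix t1 r1 t2 r2 :: real and n1 n2 :: "real^3"
  assume uw: "u = (t1, r1, n1)" "w = (t2, r2, n2)"
  have l: "((\<lambda>x. x\<^sup>2 + a\<^sup>2 * (n $ 3)\<^sup>2) has_real_derivative 2 * r) (at r)"
    by (auto intro!: derivative_eq_intros)
  show ?thesis
    unfolding uw kerr_metric_dragging_form[OF assms(1)] kerr_metric_dr.simps Let_def
    by (rule DERIV_cong, (rule DERIV_add DERIV_cmult_right DERIV_const l
          kerr_metric_coeff_r_deriv(1)[OF assms(2)] kerr_metric_coeff_r_deriv(2)[OF assms(3)])+) simp
qed

section \<open>Metric components in the charts\<close>

lemma bilinear_lincomb:
  fixes v :: "real^'n"
  assumes "bilinear (f :: 'a::real_vector \<Rightarrow> 'a \<Rightarrow> real)"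
  shows "(\<Sum>i\<in>UNIV. \<Sum>j\<in>UNIV. f (b i) (b j) * v $ i * v $ j)
    = f (\<Sum>k\<in>UNIV. v $ k *\<^sub>R b k) (\<Sum>k\<in>UNIV. v $ k *\<^sub>R b k)"
proof -
  have l: "linear (f u)" "linear (\<lambda>u. f u w)" for u w
    using assms by (simp_all add: bilinear_def)
  let ?W = "\<Sum>k\<in>UNIV. v $ k *\<^sub>R b k"
  have "f ?W ?W = (\<Sum>i\<in>UNIV. v $ i * f (b i) ?W)"
    by (simp add: linear_sum[OF l(2)] linear_scale[OF l(2)])
  also have "\<dots> = (\<Sum>i\<in>UNIV. v $ i * (\<Sum>j\<in>UNIV. v $ j * f (b i) (b j)))"
    by (simp add: linear_sum[OF l(1)] linear_scale[OF l(1)])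
  finally show ?thesis by (simp add: sum_distrib_left mult_ac)
qed

text \<open>The frame is constant along the coordinate line, so only the base point of the metric
  varies.\<close>

lemma partial_deriv_kerr_components_r:
  assumes \<phi>: "\<And>h. \<phi> (x + h *\<^sub>R axis 1 1) = (t, r + h, n)"
    and frame: "\<And>h k. partial_deriv k \<phi> (x + h *\<^sub>R axis 1 1) = partial_deriv k \<phi> x"
    and "norm n = 1" "r\<^sup>2 + a\<^sup>2 * (n $ 3)\<^sup>2 \<noteq> 0" "kerr_Delta m a r \<noteq> 0"
  shows "partial_deriv 1 (\<lambda>y. metric_components (kerr_metric m a) \<phi> y $ i $ j) x
    = kerr_metric_dr m a (t, r, n) (partial_deriv i \<phi> x) (partial_deriv j \<phi> x)"
proof -
  have "((\<lambda>h. kerr_metric m a (t, r + h, n) (partial_deriv i \<phi> x) (partial_deriv j \<phi> x))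
    has_real_derivative kerr_metric_dr m a (t, r, n) (partial_deriv i \<phi> x) (partial_deriv j \<phi> x)) (at 0)"
    using kerr_metric_r_deriv[OF assms(3-5)] by (simp add: DERIV_shift[of _ _ 0 r, simplified] add.commute)
  then show ?thesis
    unfolding partial_deriv_def[of 1] metric_components_def \<phi> frame
    by (simp add: has_real_derivative_iff_has_vector_derivative vector_derivative_at)
qed

lemma partial_deriv_kerr_components_t:
  fixes \<phi> :: "real^4 \<Rightarrow> point"
  assumes \<phi>: "\<And>h. \<phi> (x + h *\<^sub>R axis 4 1) = (t + h, r, n)"
    and frame: "\<And>h k. partial_deriv k \<phi> (x + h *\<^sub>R axis 4 1) = partial_deriv k \<phi> x"
  shows "partial_deriv 4 (\<lambda>y. metric_components (kerr_metric m a) \<phi> y $ i $ j) x = 0"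
proof -
  have *: "kerr_metric m a (t + h, r, n) u w = kerr_metric m a (t, r, n) u w" for h u w
    by (cases u; cases w) (simp only: kerr_metric.simps)
  have "\<phi> x = (t, r, n)" using \<phi>[of 0] by simp
  then show ?thesis
    by (intro partial_deriv_const_along allI) (simp only: metric_components_def \<phi> frame vec_lambda_beta *)
qed

text \<open>Differentiability is read off the dragging form, a rational expression. It agrees with
  the metric only over unit vectors, which is why the norm is controlled on a whole ball around
  \<open>x\<close>.\<close>

lemma differentiable_kerr_metric:
  fixes p u w :: "real^'n \<Rightarrow> point"
  assumes "p differentiable at x" "u differentiable at x" "w differentiable at x"
    and "e > 0" and norm: "\<And>y. dist y x < e \<Longrightarrow> norm (snd (snd (p y))) = 1"
    and nz: "(fst (snd (p x)))\<^sup>2 + a\<^sup>2 * (snd (snd (p x)) $ 3)\<^sup>2 \<noteq> 0" "kerr_Delta m a (fst (snd (p x))) \<noteq> 0"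
  shows "(\<lambda>y. kerr_metric m a (p y) (u y) (w y)) differentiable at x"
proof -
  have lin: "(\<lambda>y. f (q y)) differentiable at x" if "bounded_linear f" "q differentiable at x" for f :: "point \<Rightarrow> 'b::real_normed_vector" and q :: "real^'n \<Rightarrow> point"
    using that differentiable_compose[of f q x UNIV] bounded_linear_imp_differentiable by blast
  have nth: "bounded_linear (\<lambda>p::point. snd (snd p) $ i)" for i
    by (intro bounded_linear_compose[OF bounded_linear_vec_nth] bounded_linear_intros)
  have d: "(\<lambda>y. fst (q y)) differentiable at x" "(\<lambda>y. fst (snd (q y))) differentiable at x"
      "(\<lambda>y. snd (snd (q y))) differentiable at x" "(\<lambda>y. snd (snd (q y)) $ i) differentiable at x"
    if "q differentiable at x" for q :: "real^'n \<Rightarrow> point" and i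
    by (rule lin[OF _ that], intro nth bounded_linear_intros)+
  note d' = d[OF assms(1)] d[OF assms(2)] d[OF assms(3)]
  have "(\<lambda>y. - fst (u y) * fst (w y) + a\<^sup>2 * azimuth_form (snd (snd (p y))) (snd (snd (u y))) * azimuth_form (snd (snd (p y))) (snd (snd (w y)))
    + 2 * m * fst (snd (p y)) / ((fst (snd (p y)))\<^sup>2 + a\<^sup>2 * (snd (snd (p y)) $ 3)\<^sup>2) *
      (fst (u y) - a * azimuth_form (snd (snd (p y))) (snd (snd (u y)))) * (fst (w y) - a * azimuth_form (snd (snd (p y))) (snd (snd (w y))))
    + ((fst (snd (p y)))\<^sup>2 + a\<^sup>2 * (snd (snd (p y)) $ 3)\<^sup>2) / kerr_Delta m a (fst (snd (p y))) * fst (snd (u y)) * fst (snd (w y))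
    + ((fst (snd (p y)))\<^sup>2 + a\<^sup>2 * (snd (snd (p y)) $ 3)\<^sup>2) * (snd (snd (u y)) \<bullet> snd (snd (w y)))) differentiable at x"
    (is "?F differentiable _")
    unfolding azimuth_form_def kerr_Delta_def
    by (intro differentiable_add differentiable_mult differentiable_divide differentiable_diff differentiable_minus
      differentiable_const differentiable_power differentiable_inner d' nz[unfolded kerr_Delta_def])
  then show ?thesis
  proof (rule differentiable_transform_within[OF _ \<open>e > 0\<close>])
    show "?F y = kerr_metric m a (p y) (u y) (w y)" if "dist y x < e" for y
      using kerr_metric_dragging_form[OF norm[OF that], of m a "fst (p y)" "fst (snd (p y))"
         "fst (u y)" "fst (snd (u y))" "snd (snd (u y))" "fst (w y)" "fst (snd (w y))" "snd (snd (w y))"]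
      by (simp only: prod.collapse)
  qed simp
qed

lemma differentiable_Pair:
  assumes "f differentiable at x within S" "g differentiable at x within S"
  shows "(\<lambda>x. (f x, g x)) differentiable at x within S"
  using assms has_derivative_Pair unfolding differentiable_def by blast

lemma differentiable_vector_3:
  fixes f g h :: "real^'n \<Rightarrow> real"
  assumes "f differentiable at x" "g differentiable at x" "h differentiable at x"
  shows "(\<lambda>x. vector [f x, g x, h x] :: real^3) differentiable at x"
proof -
  have eq: "(vector [x, y, z] :: real^3) = x *\<^sub>R axis 1 1 + y *\<^sub>R axis 2 1 + z *\<^sub>R axis 3 1" for x y z
    by (simp add: vec_eq_iff forall_3 axis_def)
  show ?thesis
    unfolding eq by (intro differentiable_add differentiable_scaleR differentiable_const assms)
qed

lemma differentiable_vec_nth: "(\<lambda>x::real^'n. x $ i) differentiable at x"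
  by (rule bounded_linear_imp_differentiable[OF bounded_linear_vec_nth])

lemma differentiable_sin_cos:
  fixes f :: "real^'n \<Rightarrow> real"
  assumes "f differentiable at x"
  shows "(\<lambda>x. sin (f x)) differentiable at x" "(\<lambda>x. cos (f x)) differentiable at x"
  using assms has_derivative_sin has_derivative_cos unfolding differentiable_def by blast+

section \<open>Smoothness and nondegeneracy in the Boyer-Lindquist charts\<close>

lemma BL_param_differentiable: "BL_param differentiable at x"
  unfolding BL_param_def[abs_def]
  by (intro differentiable_Pair differentiable_vector_3 differentiable_mult differentiable_sin_cos differentiable_vec_nth)

lemma partial_deriv_BL_param_differentiable: "partial_deriv i BL_param differentiable at x"
proof -
  have "(\<lambda>x. (0, 1, 0) :: point) differentiable at x" "(\<lambda>x. (1, 0, 0) :: point) differentiable at x"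
    "(\<lambda>x. (0, 0, vector [cos (x $ 2) * cos (x $ 3), cos (x $ 2) * sin (x $ 3), - sin (x $ 2)]) :: point) differentiable at x"
    "(\<lambda>x. (0, 0, vector [- (sin (x $ 2) * sin (x $ 3)), sin (x $ 2) * cos (x $ 3), 0]) :: point) differentiable at x"
    by (intro differentiable_Pair differentiable_vector_3 differentiable_mult differentiable_minus differentiable_const
        differentiable_sin_cos differentiable_vec_nth)+
  moreover have "partial_deriv i BL_param \<in> {\<lambda>x. (0, 1, 0), \<lambda>x. (1, 0, 0),
     \<lambda>x. (0, 0, vector [cos (x $ 2) * cos (x $ 3), cos (x $ 2) * sin (x $ 3), - sin (x $ 2)]),
     \<lambda>x. (0, 0, vector [- (sin (x $ 2) * sin (x $ 3)), sin (x $ 2) * cos (x $ 3), 0])}"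
    using exhaust_4[of i] by (auto simp: partial_deriv_BL_param fun_eq_iff)
  ultimately show ?thesis by auto
qed

text \<open>The matrix has trivial kernel: the (r, \<theta>) block is diagonal with nonzero entries,
  and the (\<phi>, t) block has determinant -\<triangle> sin^2 \<theta>.\<close>

lemma BL_invertible:
  assumes "0 < x $ 2" "x $ 2 < pi" "kerr_lambda a (x $ 1) (x $ 2) \<noteq> 0" "kerr_Delta m a (x $ 1) \<noteq> 0"
  shows "invertible (metric_components (kerr_metric m a) BL_param x)"
proof -
  define r \<theta> where "r = x $ 1" and "\<theta> = x $ 2"
  define l where "l = kerr_lambda a r \<theta>"
  define S where "S = (sin \<theta>)\<^sup>2"
  have S: "S \<noteq> 0" using assms(1,2) sin_gt_zero[of \<theta>] by (auto simp: S_def \<theta>_def)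
  have l: "l \<noteq> 0" using assms(3) by (simp add: l_def r_def \<theta>_def)
  have D: "kerr_Delta m a r \<noteq> 0" using assms(4) by (simp add: r_def)
  have lA: "l = r\<^sup>2 + a\<^sup>2 - a\<^sup>2 * S" by (simp add: l_def S_def kerr_lambda_def cos_squared_eq algebra_simps)
  define k where "k = 2 * m * r / l"
  have k: "k * l = 2 * m * r" using l by (simp add: k_def)
  have g33: "(r\<^sup>2 + a\<^sup>2 + 2 * m * r * a\<^sup>2 * S / l) * S = (r\<^sup>2 + a\<^sup>2 + k * a\<^sup>2 * S) * S"
    by (simp add: k_def)
  have g34: "- (2 * m * r * a * S / l) = - k * a * S"
    by (simp add: k_def)
  have g44: "- 1 + 2 * m * r / l = - 1 + k"
    by (simp add: k_def)
  have "w = 0" if w: "kerr_BL_matrix m a r \<theta> *v w = 0" for w :: "real^4"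
  proof -
    have e: "l / kerr_Delta m a r * w $ 1 = 0" "l * w $ 2 = 0"
      "(r\<^sup>2 + a\<^sup>2 + k * a\<^sup>2 * S) * S * w $ 3 - k * a * S * w $ 4 = 0"
      "- k * a * S * w $ 3 + (- 1 + k) * w $ 4 = 0"
      using w unfolding kerr_BL_matrix_def Let_def l_def[symmetric] S_def[symmetric] g33 g34 g44
      by (simp_all add: vec_eq_iff forall_4 matrix_vector_mult_def sum_4)
    have w12: "w $ 1 = 0" "w $ 2 = 0" using e(1,2) l D by auto
    have e3: "(r\<^sup>2 + a\<^sup>2 + k * a\<^sup>2 * S) * w $ 3 - k * a * w $ 4 = 0"
    proof -
      have "S * ((r\<^sup>2 + a\<^sup>2 + k * a\<^sup>2 * S) * w $ 3 - k * a * w $ 4) = 0" using e(3) by algebra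
      then show ?thesis using S by simp
    qed
    \<comment> \<open>After the factor \<open>S\<close> has been divided out of the third row, the
      determinant of the (\<phi>, t) block is independent of the angle.\<close>
    have det: "(r\<^sup>2 + a\<^sup>2 + k * a\<^sup>2 * S) * (- 1 + k) - k * a * (k * a * S) = - kerr_Delta m a r"
      using k lA unfolding kerr_Delta_def by algebra
    have "kerr_Delta m a r * w $ 3 = 0" "kerr_Delta m a r * w $ 4 = 0"
      using e3 e(4) det by algebra+
    then show ?thesis using w12 D by (simp add: vec_eq_iff forall_4)
  qed
  then have "\<exists>B. B ** kerr_BL_matrix m a r \<theta> = mat 1"
    using matrix_left_invertible_ker by blast
  then show ?thesis
    unfolding metric_components_BL r_def[symmetric] \<theta>_def[symmetric] invertible_left_inverse .
qed

section \<open>Smoothness and nondegeneracy in the polar charts\<close>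

lemma open_polar_domain: "open polar_domain"
  unfolding polar_domain_def by (intro open_Collect_less continuous_intros)

lemma polar_param_shift:
  "polar_param \<sigma> (x + h *\<^sub>R axis 1 1) = polar_param \<sigma> x + (0, h, 0)"
  "polar_param \<sigma> (x + h *\<^sub>R axis 4 1) = polar_param \<sigma> x + (h, 0, 0)"
  by (simp_all add: polar_param_def)

lemma partial_deriv_polar_param:
  assumes "x \<in> polar_domain"
  shows "partial_deriv 1 (polar_param \<sigma>) x = (0, 1, 0)"
    "partial_deriv 2 (polar_param \<sigma>) x = (0, 0, vector [1, 0, - \<sigma> * x $ 2 / sqrt (1 - (x $ 2)\<^sup>2 - (x $ 3)\<^sup>2)])"
    "partial_deriv 3 (polar_param \<sigma>) x = (0, 0, vector [0, 1, - \<sigma> * x $ 3 / sqrt (1 - (x $ 2)\<^sup>2 - (x $ 3)\<^sup>2)])"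
    "partial_deriv 4 (polar_param \<sigma>) x = (1, 0, 0)"
proof -
  have pos: "1 - (x $ 2)\<^sup>2 - (x $ 3)\<^sup>2 > 0" using assms by (simp add: polar_domain_def)
  show "partial_deriv 1 (polar_param \<sigma>) x = (0, 1, 0)" "partial_deriv 4 (polar_param \<sigma>) x = (1, 0, 0)"
    unfolding partial_deriv_def polar_param_shift
    by (rule vector_derivative_at, auto simp: polar_param_def zero_prod_def intro!: derivative_eq_intros has_vector_derivative_Pair)+
  have 2: "((\<lambda>h. \<sigma> * sqrt (1 - (x $ 2 + h)\<^sup>2 - (x $ 3)\<^sup>2)) has_real_derivative
      - \<sigma> * x $ 2 / sqrt (1 - (x $ 2)\<^sup>2 - (x $ 3)\<^sup>2)) (at 0)"
    using pos by (auto intro!: derivative_eq_intros simp: field_simps)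
  have 3: "((\<lambda>h. \<sigma> * sqrt (1 - (x $ 2)\<^sup>2 - (x $ 3 + h)\<^sup>2)) has_real_derivative
      - \<sigma> * x $ 3 / sqrt (1 - (x $ 2)\<^sup>2 - (x $ 3)\<^sup>2)) (at 0)"
    using pos by (auto intro!: derivative_eq_intros simp: field_simps)
  show "partial_deriv 2 (polar_param \<sigma>) x = (0, 0, vector [1, 0, - \<sigma> * x $ 2 / sqrt (1 - (x $ 2)\<^sup>2 - (x $ 3)\<^sup>2)])"
    unfolding partial_deriv_def polar_param_def
    by (rule vector_derivative_at, intro has_vector_derivative_Pair has_vector_derivative_vector_3)
       (use 2 in \<open>auto intro!: derivative_eq_intros\<close>)
  show "partial_deriv 3 (polar_param \<sigma>) x = (0, 0, vector [0, 1, - \<sigma> * x $ 3 / sqrt (1 - (x $ 2)\<^sup>2 - (x $ 3)\<^sup>2)])"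
    unfolding partial_deriv_def polar_param_def
    by (rule vector_derivative_at, intro has_vector_derivative_Pair has_vector_derivative_vector_3)
       (use 3 in \<open>auto intro!: derivative_eq_intros\<close>)
qed

lemma differentiable_sqrt:
  fixes f :: "real^'n \<Rightarrow> real"
  assumes "f differentiable at x" "f x > 0"
  shows "(\<lambda>x. sqrt (f x)) differentiable at x"
  using assms has_derivative_real_sqrt unfolding differentiable_def by blast

lemma polar_param_differentiable:
  assumes "x \<in> polar_domain"
  shows "polar_param \<sigma> differentiable at x"
  unfolding polar_param_def[abs_def] using assms
  by (intro differentiable_Pair differentiable_vector_3 differentiable_mult differentiable_const differentiable_vec_nth
      differentiable_sqrt differentiable_diff differentiable_power) (simp add: polar_domain_def)

lemma partial_deriv_polar_param_differentiable:
  assumes "x \<in> polar_domain"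
  shows "partial_deriv i (polar_param \<sigma>) differentiable at x"
proof -
  obtain e where e: "e > 0" "ball x e \<subseteq> polar_domain"
    using open_polar_domain assms openE by blast
  have "1 - (x $ 2)\<^sup>2 - (x $ 3)\<^sup>2 > 0" using assms by (simp add: polar_domain_def)
  then have d: "(\<lambda>x. (0, 1, 0) :: point) differentiable at x" "(\<lambda>x. (1, 0, 0) :: point) differentiable at x"
    "(\<lambda>x. (0, 0, vector [1, 0, - \<sigma> * x $ 2 / sqrt (1 - (x $ 2)\<^sup>2 - (x $ 3)\<^sup>2)]) :: point) differentiable at x"
    "(\<lambda>x. (0, 0, vector [0, 1, - \<sigma> * x $ 3 / sqrt (1 - (x $ 2)\<^sup>2 - (x $ 3)\<^sup>2)]) :: point) differentiable at x"
    by (intro differentiable_Pair differentiable_vector_3 differentiable_mult differentiable_divide differentiable_minus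
        differentiable_const differentiable_sqrt differentiable_diff differentiable_power differentiable_vec_nth; simp)+
  have D: "y \<in> polar_domain" if "dist y x < e" for y
    using e(2) that by (auto simp: dist_commute)
  have "partial_deriv 1 (polar_param \<sigma>) differentiable at x"
    by (rule differentiable_transform_within[OF d(1) e(1) UNIV_I]) (simp add: partial_deriv_polar_param[OF D])
  moreover have "partial_deriv 2 (polar_param \<sigma>) differentiable at x"
    by (rule differentiable_transform_within[OF d(3) e(1) UNIV_I]) (simp add: partial_deriv_polar_param[OF D])
  moreover have "partial_deriv 3 (polar_param \<sigma>) differentiable at x"
    by (rule differentiable_transform_within[OF d(4) e(1) UNIV_I]) (simp add: partial_deriv_polar_param[OF D])
  moreover have "partial_deriv 4 (polar_param \<sigma>) differentiable at x"
    by (rule differentiable_transform_within[OF d(2) e(1) UNIV_I]) (simp add: partial_deriv_polar_param[OF D])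
  ultimately show ?thesis using exhaust_4[of i] by metis
qed

text \<open>The polar charts are only needed at points of the axis; all others lie in a Boyer--Lindquist chart.\<close>

lemma polar_invertible:
  assumes "x $ 2 = 0" "x $ 3 = 0" "\<sigma> = 1 \<or> \<sigma> = -1" "m\<^sup>2 < a\<^sup>2"
  shows "invertible (metric_components (kerr_metric m a) (polar_param \<sigma>) x)"
proof -
  define r where "r = x $ 1"
  have D: "kerr_Delta m a r > 0" using assms(4) by (rule kerr_Delta_pos)
  have a: "a\<^sup>2 > 0" using assms(4) by (smt (verit) zero_le_power2)
  then have l: "r\<^sup>2 + a\<^sup>2 > 0" by (simp add: add_nonneg_pos)
  define n :: "real^3" where "n = vector [0, 0, \<sigma>]"
  have n: "norm n = 1" using assms(3) by (auto simp: n_def norm_eq_1 inner_vec_def sum_3)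
  have \<sigma>2: "\<sigma>\<^sup>2 = 1" using assms(3) by auto
  have az: "azimuth_form n w = 0" for w by (simp add: azimuth_form_def n_def)
  have p: "polar_param \<sigma> x = (x $ 4, r, n)"
    using assms(1,2) by (simp add: polar_param_def n_def r_def)
  have "x \<in> polar_domain" using assms(1,2) by (simp add: polar_domain_def)
  note P = partial_deriv_polar_param[OF this, of \<sigma>, unfolded assms(1,2), simplified]
  \<comment> \<open>The value of g44 on the axis, which equals -\<triangle>/(r^2 + a^2) and
    therefore does not vanish.\<close>
  define k where "k = - 1 + 2 * m * r / (r\<^sup>2 + a\<^sup>2)"
  have k: "k * (r\<^sup>2 + a\<^sup>2) = - kerr_Delta m a r"
  proof -
    have "2 * m * r / (r\<^sup>2 + a\<^sup>2) * (r\<^sup>2 + a\<^sup>2) = 2 * m * r" using l by simp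
    then show ?thesis unfolding k_def distrib_right by (simp add: kerr_Delta_def)
  qed
  have g: "kerr_metric m a (polar_param \<sigma> x) (t1, r1, n1) (t2, r2, n2)
      = k * t1 * t2 + (r\<^sup>2 + a\<^sup>2) / kerr_Delta m a r * r1 * r2 + (r\<^sup>2 + a\<^sup>2) * (n1 \<bullet> n2)" for t1 r1 n1 t2 r2 n2
    unfolding p kerr_metric_dragging_form[OF n] az by (simp add: n_def \<sigma>2 k_def left_diff_distrib)
  have "w = 0" if w: "metric_components (kerr_metric m a) (polar_param \<sigma>) x *v w = 0" for w :: "real^4"
  proof -
    have "(r\<^sup>2 + a\<^sup>2) / kerr_Delta m a r * w $ 1 = 0" "(r\<^sup>2 + a\<^sup>2) * w $ 2 = 0" "(r\<^sup>2 + a\<^sup>2) * w $ 3 = 0" "k * w $ 4 = 0"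
      using w by (simp_all add: vec_eq_iff forall_4 matrix_vector_mult_def sum_4 metric_components_def P g inner_vec_def sum_3)
    moreover have "k \<noteq> 0" using k D by auto
    ultimately show ?thesis using a D by (simp add: vec_eq_iff forall_4)
  qed
  then have "\<exists>B. B ** metric_components (kerr_metric m a) (polar_param \<sigma>) x = mat 1"
    using matrix_left_invertible_ker by blast
  then show ?thesis unfolding invertible_left_inverse .
qed

lemma kerr_spacetimeD:
  assumes "p \<in> kerr_spacetime a"
  shows "norm (snd (snd p)) = 1" "(fst (snd p))\<^sup>2 + a\<^sup>2 * (snd (snd p) $ 3)\<^sup>2 > 0"
proof -
  obtain t r n where p: "p = (t, r, n)" by (cases p)
  show n: "norm (snd (snd p)) = 1" using assms by (simp add: p kerr_spacetime_def)
  have "r\<^sup>2 + a\<^sup>2 * (n $ 3)\<^sup>2 \<noteq> 0"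
    using assms cos_colatitude[of n] n by (simp add: p kerr_spacetime_def kerr_lambda_def)
  then show "(fst (snd p))\<^sup>2 + a\<^sup>2 * (snd (snd p) $ 3)\<^sup>2 > 0"
    by (simp add: p order_less_le)
qed

text \<open>In both kinds of chart the coordinates r and t act by translations that leave the frame
  unchanged, so the energy law and the radial law are derived here once. The rotational law, for
  which the charts differ, has to be extracted later from the general law for the index
  \<open>l\<close>.\<close>

lemma kerr_geodesic_laws_in_chart:
  fixes \<gamma> :: "real \<Rightarrow> point"
  assumes geo: "is_geodesic (kerr_metric m a) kerr_atlas \<gamma>" "\<gamma> ` {0..1} \<subseteq> kerr_spacetime a" and fast: "m\<^sup>2 < a\<^sup>2"
    and chart: "(U, \<phi>) \<in> kerr_atlas" and s0: "s0 \<in> {0..1}"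
    and V: "open V" "\<gamma> s0 \<in> V" "\<And>s. s \<in> {0..1} \<Longrightarrow> \<gamma> s \<in> V \<Longrightarrow> \<gamma> s \<in> \<phi> ` U"
    and \<phi>_diff: "\<And>y. y \<in> U \<Longrightarrow> \<phi> differentiable at y"
    and frame_diff: "\<And>y k. y \<in> U \<Longrightarrow> partial_deriv k \<phi> differentiable at y"
    and inv: "\<And>y. y \<in> U \<Longrightarrow> \<phi> y = \<gamma> s0 \<Longrightarrow> invertible (metric_components (kerr_metric m a) \<phi> y)"
    and U: "open U" "\<And>y. y \<in> U \<Longrightarrow> norm (snd (snd (\<phi> y))) = 1"
    and shift: "\<And>y h. \<phi> (y + h *\<^sub>R axis 1 1) = \<phi> y + (0, h, 0)" "\<And>y h. \<phi> (y + h *\<^sub>R axis 4 1) = \<phi> y + (h, 0, 0)"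
    and frame: "\<And>y h k. y \<in> U \<Longrightarrow> partial_deriv k \<phi> (y + h *\<^sub>R axis 1 1) = partial_deriv k \<phi> y"
      "\<And>y h k. y \<in> U \<Longrightarrow> partial_deriv k \<phi> (y + h *\<^sub>R axis 4 1) = partial_deriv k \<phi> y"
      "\<And>y. y \<in> U \<Longrightarrow> partial_deriv 1 \<phi> y = (0, 1, 0)" "\<And>y. y \<in> U \<Longrightarrow> partial_deriv 4 \<phi> y = (1, 0, 0)"
  defines "\<gamma>' \<equiv> \<lambda>s. vector_derivative \<gamma> (at s within {0..1})"
  obtains x v e where "e > 0"
    "\<And>s. s \<in> {0..1} \<Longrightarrow> dist s s0 < e \<Longrightarrow> x s \<in> U \<and> \<phi> (x s) = \<gamma> s"
    "\<And>s. s \<in> {0..1} \<Longrightarrow> dist s s0 < e \<Longrightarrow> (x has_vector_derivative v s) (at s within {0..1})"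
    "\<gamma>' s0 = (\<Sum>k\<in>UNIV. v s0 $ k *\<^sub>R partial_deriv k \<phi> (x s0))"
    "(\<gamma> has_vector_derivative \<gamma>' s0) (at s0 within {0..1})"
    "\<And>l. ((\<lambda>s. kerr_metric m a (\<gamma> s) (partial_deriv l \<phi> (x s)) (\<gamma>' s)) has_real_derivative
       (\<Sum>i\<in>UNIV. \<Sum>j\<in>UNIV. partial_deriv l (\<lambda>y. metric_components (kerr_metric m a) \<phi> y $ i $ j) (x s0) * v s0 $ i * v s0 $ j) / 2)
         (at s0 within {0..1})"
    "((\<lambda>s. kerr_metric m a (\<gamma> s) (1, 0, 0) (\<gamma>' s)) has_real_derivative 0) (at s0 within {0..1})"
    "((\<lambda>s. kerr_metric m a (\<gamma> s) (0, 1, 0) (\<gamma>' s)) has_real_derivative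
        kerr_metric_dr m a (\<gamma> s0) (\<gamma>' s0) (\<gamma>' s0) / 2) (at s0 within {0..1})"
    "((\<lambda>s. kerr_metric m a (\<gamma> s) (\<gamma>' s) (\<gamma>' s)) has_real_derivative 0) (at s0 within {0..1})"
proof -
  have \<gamma>s0: "\<gamma> s0 \<in> kerr_spacetime a" using geo(2) s0 by auto
  obtain t r n where trn: "\<gamma> s0 = (t, r, n)" by (cases "\<gamma> s0")
  have n: "norm n = 1" and l: "r\<^sup>2 + a\<^sup>2 * (n $ 3)\<^sup>2 \<noteq> 0"
    using kerr_spacetimeD[OF \<gamma>s0] by (simp_all add: trn)
  have D: "kerr_Delta m a r \<noteq> 0" using kerr_Delta_pos[OF fast, of r] by simp
  have G_diff: "(\<lambda>z. metric_components (kerr_metric m a) \<phi> z $ i $ j) differentiable at y"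
    if y: "y \<in> U" "\<phi> y = \<gamma> s0" for y i j
  proof -
    obtain e where e: "e > 0" "ball y e \<subseteq> U" using U(1) y openE by blast
    have "norm (snd (snd (\<phi> z))) = 1" if "dist z y < e" for z
      using e(2) that by (intro U(2)) (auto simp: dist_commute)
    then have "(\<lambda>z. kerr_metric m a (\<phi> z) (partial_deriv i \<phi> z) (partial_deriv j \<phi> z)) differentiable at y"
      using l D y by (intro differentiable_kerr_metric[OF _ _ _ e(1)] \<phi>_diff frame_diff) (auto simp: trn)
    then show ?thesis by (simp add: metric_components_def)
  qed
  obtain x v e where e: "e > 0"
    and x: "\<And>s. s \<in> {0..1} \<Longrightarrow> dist s s0 < e \<Longrightarrow> x s \<in> U \<and> \<phi> (x s) = \<gamma> s"
    and rest: "\<And>s. s \<in> {0..1} \<Longrightarrow> dist s s0 < e \<Longrightarrow> (x has_vector_derivative v s) (at s within {0..1})"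
    "\<gamma>' s0 = (\<Sum>k\<in>UNIV. v s0 $ k *\<^sub>R partial_deriv k \<phi> (x s0))"
    "(\<gamma> has_vector_derivative \<gamma>' s0) (at s0 within {0..1})"
    "\<And>l. ((\<lambda>s. kerr_metric m a (\<gamma> s) (partial_deriv l \<phi> (x s)) (\<gamma>' s)) has_real_derivative
       (\<Sum>i\<in>UNIV. \<Sum>j\<in>UNIV. partial_deriv l (\<lambda>y. metric_components (kerr_metric m a) \<phi> y $ i $ j) (x s0) * v s0 $ i * v s0 $ j) / 2)
         (at s0 within {0..1})"
    "((\<lambda>s. kerr_metric m a (\<gamma> s) (\<gamma>' s) (\<gamma>' s)) has_real_derivative 0) (at s0 within {0..1})"
    unfolding \<gamma>'_def
    by (rule geodesic_laws_in_chart[OF geo(1) chart kerr_atlas_inj[OF chart] s0 V bilinear_kerr_metric kerr_metric_sym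
          \<phi>_diff inv G_diff]) blast+
  have x0: "x s0 \<in> U" "\<phi> (x s0) = (t, r, n)" using x[OF s0] e trn by auto
  have "(\<Sum>i\<in>UNIV. \<Sum>j\<in>UNIV. partial_deriv 1 (\<lambda>y. metric_components (kerr_metric m a) \<phi> y $ i $ j) (x s0) * v s0 $ i * v s0 $ j)
    = kerr_metric_dr m a (\<gamma> s0) (\<gamma>' s0) (\<gamma>' s0)"
    unfolding rest(2) bilinear_lincomb[OF bilinear_kerr_metric_dr, symmetric] trn
    by (subst partial_deriv_kerr_components_r[OF _ frame(1)[OF x0(1)] n l D]) (auto simp: shift x0)
  then have r_law: "((\<lambda>s. kerr_metric m a (\<gamma> s) (partial_deriv 1 \<phi> (x s)) (\<gamma>' s)) has_real_derivative
        kerr_metric_dr m a (\<gamma> s0) (\<gamma>' s0) (\<gamma>' s0) / 2) (at s0 within {0..1})"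
    using rest(4)[of 1] by simp
  have "partial_deriv 4 (\<lambda>y. metric_components (kerr_metric m a) \<phi> y $ i $ j) (x s0) = 0" for i j
    by (rule partial_deriv_kerr_components_t[OF _ frame(2)[OF x0(1)], of t r n]) (simp add: shift x0)
  then have t_law: "((\<lambda>s. kerr_metric m a (\<gamma> s) (partial_deriv 4 \<phi> (x s)) (\<gamma>' s)) has_real_derivative 0) (at s0 within {0..1})"
    using rest(4)[of 4] by simp
  show thesis
  proof (rule that[OF e x rest(1-4)])
    show "((\<lambda>s. kerr_metric m a (\<gamma> s) (1, 0, 0) (\<gamma>' s)) has_real_derivative 0) (at s0 within {0..1})"
      by (rule has_field_derivative_transform_within[OF t_law e s0]) (use x frame(4) in force)
    show "((\<lambda>s. kerr_metric m a (\<gamma> s) (0, 1, 0) (\<gamma>' s)) has_real_derivative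
        kerr_metric_dr m a (\<gamma> s0) (\<gamma>' s0) (\<gamma>' s0) / 2) (at s0 within {0..1})"
      by (rule has_field_derivative_transform_within[OF r_law e s0]) (use x frame(3) in force)
  qed (use rest(5) in auto)
qed

section \<open>Conservation laws\<close>

text \<open>The rotational Killing field as an ambient vector field. Off the axis it is the
  coordinate field of the longitude; on the axis it vanishes, which forces zero angular momentum on
  every geodesic that starts there.\<close>

definition axial_rotation :: "point \<Rightarrow> point" where
  "axial_rotation p = (0, 0, vector [- (snd (snd p) $ 2), snd (snd p) $ 1, 0])"

lemma polar_angle_exists:
  fixes x y \<psi> :: real
  assumes "x * cos \<psi> + y * sin \<psi> > 0"
  obtains \<rho> \<omega> where "\<rho> > 0" "\<psi> - pi < \<omega>" "\<omega> < \<psi> + pi" "x = \<rho> * cos \<omega>" "y = \<rho> * sin \<omega>"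
proof
  \<comment> \<open>These are the coordinates of the point in the frame rotated by
    \<open>\<psi>\<close>. As \<open>p > 0\<close>, the angle relative to \<open>\<psi>\<close> is
    an arctangent, hence less than pi/2 in absolute value.\<close>
  define p q where "p = x * cos \<psi> + y * sin \<psi>" and "q = y * cos \<psi> - x * sin \<psi>"
  have p: "p > 0" using assms by (simp add: p_def)
  let ?\<tau> = "arctan (q / p)"
  let ?\<rho> = "p * sqrt (1 + (q / p)\<^sup>2)"
  have s: "sqrt (1 + (q / p)\<^sup>2) > 0" by (simp add: add_pos_nonneg)
  show "?\<rho> > 0" using p s by simp
  show "\<psi> - pi < \<psi> + ?\<tau>" "\<psi> + ?\<tau> < \<psi> + pi"
    using arctan_lbound[of "q / p"] arctan_ubound[of "q / p"] pi_gt_zero by linarith+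
  have c: "?\<rho> * cos ?\<tau> = p" "?\<rho> * sin ?\<tau> = q"
    using p s by (simp_all add: cos_arctan sin_arctan)
  have id: "cos \<psi> * cos \<psi> + sin \<psi> * sin \<psi> = 1"
    using sin_cos_squared_add2[of \<psi>] by (simp add: power2_eq_square)
  have "?\<rho> * cos (\<psi> + ?\<tau>) = (?\<rho> * cos ?\<tau>) * cos \<psi> - (?\<rho> * sin ?\<tau>) * sin \<psi>"
    unfolding cos_add by algebra
  also have "\<dots> = p * cos \<psi> - q * sin \<psi>" by (simp only: c)
  also have "\<dots> = x" unfolding p_def q_def using id by algebra
  finally show "x = ?\<rho> * cos (\<psi> + ?\<tau>)" ..
  have "?\<rho> * sin (\<psi> + ?\<tau>) = (?\<rho> * cos ?\<tau>) * sin \<psi> + (?\<rho> * sin ?\<tau>) * cos \<psi>"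
    unfolding sin_add by algebra
  also have "\<dots> = p * sin \<psi> + q * cos \<psi>" by (simp only: c)
  also have "\<dots> = y" unfolding p_def q_def using id by algebra
  finally show "y = ?\<rho> * sin (\<psi> + ?\<tau>)" ..
qed

text \<open>The strict inequality cuts out an open half-space, which serves as the open set
  \<open>V\<close> detecting membership in the chart whose cut lies opposite to the longitude
  \<open>\<psi>\<close>. A point off the axis satisfies it when \<open>\<psi>\<close> is its own
  longitude.\<close>

lemma BL_image:
  assumes "norm n = 1" "n $ 1 * cos \<psi> + n $ 2 * sin \<psi> > 0"
  shows "(t, r, n) \<in> BL_param ` BL_domain (\<psi> - pi)"
proof -
  obtain \<rho> \<omega> where \<rho>: "\<rho> > 0" and \<omega>: "\<psi> - pi < \<omega>" "\<omega> < \<psi> + pi"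
    and xy: "n $ 1 = \<rho> * cos \<omega>" "n $ 2 = \<rho> * sin \<omega>"
    using polar_angle_exists[OF assms(2)] by blast
  have n: "(n $ 1)\<^sup>2 + (n $ 2)\<^sup>2 + (n $ 3)\<^sup>2 = 1"
    using assms(1) by (simp add: norm_eq_1 inner_vec_def sum_3 power2_eq_square)
  have "(n $ 1)\<^sup>2 + (n $ 2)\<^sup>2 = \<rho>\<^sup>2"
    using sin_cos_squared_add[of \<omega>] unfolding xy by algebra
  then have \<rho>2: "\<rho>\<^sup>2 = 1 - (n $ 3)\<^sup>2" using n by simp
  then have "(n $ 3)\<^sup>2 < 1" using \<rho> zero_less_power2[of \<rho>] by auto
  then have z: "-1 < n $ 3" "n $ 3 < 1" by (simp_all add: abs_square_less_1 abs_less_iff)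
  have "sin (arccos (n $ 3)) = \<rho>"
    using z \<rho> by (simp add: sin_arccos \<rho>2[symmetric])
  then have "(t, r, n) = BL_param (vector [r, arccos (n $ 3), \<omega>, t])"
    using z by (simp add: BL_param_def vec_eq_iff forall_3 xy)
  moreover have "vector [r, arccos (n $ 3), \<omega>, t] \<in> BL_domain (\<psi> - pi)"
    using \<omega> arccos_lt_bounded[OF z] by (simp add: BL_domain_def)
  ultimately show ?thesis by blast
qed

lemma open_BL_domain: "open (BL_domain \<alpha>)"
  unfolding BL_domain_def by (intro open_Collect_conj open_Collect_less continuous_intros)

lemma BL_param_shift:
  "BL_param (x + h *\<^sub>R axis 1 1) = BL_param x + (0, h, 0)"
  "BL_param (x + h *\<^sub>R axis 4 1) = BL_param x + (h, 0, 0)"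
  by (simp_all add: BL_param_def)

lemma norm_BL_param: "norm (snd (snd (BL_param x))) = 1"
proof -
  have "(sin (x $ 2) * cos (x $ 3))\<^sup>2 + (sin (x $ 2) * sin (x $ 3))\<^sup>2 + (cos (x $ 2))\<^sup>2 = 1"
    using sin_cos_squared_add[of "x $ 2"] sin_cos_squared_add[of "x $ 3"] by algebra
  then show ?thesis
    by (simp add: BL_param_def norm_eq_1 inner_vec_def sum_3 power2_eq_square)
qed

lemma norm_polar_param:
  assumes "x \<in> polar_domain" "\<sigma> = 1 \<or> \<sigma> = -1"
  shows "norm (snd (snd (polar_param \<sigma> x))) = 1"
  using assms by (auto simp: polar_param_def polar_domain_def norm_eq_1 inner_vec_def sum_3 power2_eq_square)

text \<open>Off the axis, \<open>axial_rotation\<close> is the third coordinate field of a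
  Boyer-Lindquist chart, and the metric components do not depend on the longitude. On the axis no
  symmetry of the polar chart is invoked: the angular momentum is a combination of two momenta whose
  derivative vanishes there by direct computation.\<close>

lemma kerr_geodesic_laws:
  fixes \<gamma> :: "real \<Rightarrow> point"
  assumes geo: "is_geodesic (kerr_metric m a) kerr_atlas \<gamma>" "\<gamma> ` {0..1} \<subseteq> kerr_spacetime a" and fast: "m\<^sup>2 < a\<^sup>2"
    and s0: "s0 \<in> {0..1}"
  defines "\<gamma>' \<equiv> \<lambda>s. vector_derivative \<gamma> (at s within {0..1})"
  shows "(\<gamma> has_vector_derivative \<gamma>' s0) (at s0 within {0..1})"
    and "((\<lambda>s. kerr_metric m a (\<gamma> s) (1, 0, 0) (\<gamma>' s)) has_real_derivative 0) (at s0 within {0..1})"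
    and "((\<lambda>s. kerr_metric m a (\<gamma> s) (axial_rotation (\<gamma> s)) (\<gamma>' s)) has_real_derivative 0) (at s0 within {0..1})"
    and "((\<lambda>s. kerr_metric m a (\<gamma> s) (0, 1, 0) (\<gamma>' s)) has_real_derivative
        kerr_metric_dr m a (\<gamma> s0) (\<gamma>' s0) (\<gamma>' s0) / 2) (at s0 within {0..1})"
    and "((\<lambda>s. kerr_metric m a (\<gamma> s) (\<gamma>' s) (\<gamma>' s)) has_real_derivative 0) (at s0 within {0..1})"
proof (atomize(full), goal_cases)
  case 1
  obtain t r n where trn: "\<gamma> s0 = (t, r, n)" by (cases "\<gamma> s0")
  have sp: "\<gamma> s \<in> kerr_spacetime a" if "s \<in> {0..1}" for s using geo(2) that by auto
  have n1: "norm n = 1" and l: "r\<^sup>2 + a\<^sup>2 * (n $ 3)\<^sup>2 > 0"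
    using kerr_spacetimeD[OF sp[OF s0]] by (simp_all add: trn)
  have n: "(n $ 1)\<^sup>2 + (n $ 2)\<^sup>2 + (n $ 3)\<^sup>2 = 1"
    using n1 by (simp add: norm_eq_1 inner_vec_def sum_3 power2_eq_square)
  have nth: "continuous_on UNIV (\<lambda>p::point. snd (snd p) $ i)" for i
    by (intro continuous_intros)
  show ?case
  proof (cases "n $ 1 = 0 \<and> n $ 2 = 0")
    case False
    define \<rho> where "\<rho> = sqrt ((n $ 1)\<^sup>2 + (n $ 2)\<^sup>2)"
    have "(n $ 1)\<^sup>2 + (n $ 2)\<^sup>2 > 0" using False by (auto simp: sum_power2_gt_zero_iff)
    then have \<rho>: "\<rho> > 0" "\<rho>\<^sup>2 = (n $ 1)\<^sup>2 + (n $ 2)\<^sup>2" by (simp_all add: \<rho>_def)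
    have "(n $ 1 / \<rho>)\<^sup>2 + (n $ 2 / \<rho>)\<^sup>2 = \<rho>\<^sup>2 / \<rho>\<^sup>2"
      by (simp only: power_divide add_divide_distrib[symmetric] \<rho>(2))
    also have "\<dots> = 1" using \<rho>(1) by simp
    finally have "(n $ 1 / \<rho>)\<^sup>2 + (n $ 2 / \<rho>)\<^sup>2 = 1" .
    then obtain \<psi> where \<psi>: "n $ 1 / \<rho> = cos \<psi>" "n $ 2 / \<rho> = sin \<psi>"
      using sincos_total_2pi by metis
    define V where "V = {p :: point. snd (snd p) $ 1 * cos \<psi> + snd (snd p) $ 2 * sin \<psi> > 0}"
    have "open V" unfolding V_def by (intro open_Collect_less continuous_intros nth)
    have "n $ 1 = \<rho> * cos \<psi>" "n $ 2 = \<rho> * sin \<psi>" using \<rho> by (simp_all flip: \<psi>)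
    then have "n $ 1 * cos \<psi> + n $ 2 * sin \<psi> = \<rho>"
      using sin_cos_squared_add[of \<psi>] by algebra
    then have "\<gamma> s0 \<in> V" using \<rho> by (simp add: V_def trn)
    have V: "\<gamma> s \<in> BL_param ` BL_domain (\<psi> - pi)" if "s \<in> {0..1}" "\<gamma> s \<in> V" for s
      using BL_image[of "snd (snd (\<gamma> s))" \<psi> "fst (\<gamma> s)" "fst (snd (\<gamma> s))"] that(2)
        kerr_spacetimeD(1)[OF sp[OF that(1)]] by (simp add: V_def)
    have chart: "(BL_domain (\<psi> - pi), BL_param) \<in> kerr_atlas" by (auto simp: kerr_atlas_def)
    have inv: "invertible (metric_components (kerr_metric m a) BL_param y)"
      if "y \<in> BL_domain (\<psi> - pi)" "BL_param y = \<gamma> s0" for y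
    proof -
      have "r = y $ 1" "n $ 3 = cos (y $ 2)" using that(2) by (auto simp: trn BL_param_def)
      then have "kerr_lambda a (y $ 1) (y $ 2) \<noteq> 0" using l by (simp add: kerr_lambda_def)
      then show ?thesis
        using that(1) kerr_Delta_pos[OF fast, of "y $ 1"] by (intro BL_invertible) (auto simp: BL_domain_def)
    qed
    have frame: "partial_deriv k BL_param (y + h *\<^sub>R axis 1 1) = partial_deriv k BL_param y"
       "partial_deriv k BL_param (y + h *\<^sub>R axis 4 1) = partial_deriv k BL_param y" for y h k
      using exhaust_4[of k] by (auto simp: partial_deriv_BL_param)
    obtain x v e where e: "e > 0"
      and x: "\<And>s. s \<in> {0..1} \<Longrightarrow> dist s s0 < e \<Longrightarrow> x s \<in> BL_domain (\<psi> - pi) \<and> BL_param (x s) = \<gamma> s"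
      and laws: "(\<gamma> has_vector_derivative \<gamma>' s0) (at s0 within {0..1})"
    "\<And>l. ((\<lambda>s. kerr_metric m a (\<gamma> s) (partial_deriv l BL_param (x s)) (\<gamma>' s)) has_real_derivative
       (\<Sum>i\<in>UNIV. \<Sum>j\<in>UNIV. partial_deriv l (\<lambda>y. metric_components (kerr_metric m a) BL_param y $ i $ j) (x s0) * v s0 $ i * v s0 $ j) / 2)
         (at s0 within {0..1})"
    "((\<lambda>s. kerr_metric m a (\<gamma> s) (1, 0, 0) (\<gamma>' s)) has_real_derivative 0) (at s0 within {0..1})"
    "((\<lambda>s. kerr_metric m a (\<gamma> s) (0, 1, 0) (\<gamma>' s)) has_real_derivative
        kerr_metric_dr m a (\<gamma> s0) (\<gamma>' s0) (\<gamma>' s0) / 2) (at s0 within {0..1})"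
    "((\<lambda>s. kerr_metric m a (\<gamma> s) (\<gamma>' s) (\<gamma>' s)) has_real_derivative 0) (at s0 within {0..1})"
      unfolding \<gamma>'_def
      by (rule kerr_geodesic_laws_in_chart[OF geo fast chart s0 \<open>open V\<close> \<open>\<gamma> s0 \<in> V\<close> V BL_param_differentiable
          partial_deriv_BL_param_differentiable inv open_BL_domain norm_BL_param BL_param_shift frame
          partial_deriv_BL_param(1) partial_deriv_BL_param(4)]) blast+
    have "partial_deriv 3 (\<lambda>y. metric_components (kerr_metric m a) BL_param y $ i $ j) (x s0) = 0" for i j
      by (intro partial_deriv_const_along) (simp add: metric_components_BL)
    then have L: "((\<lambda>s. kerr_metric m a (\<gamma> s) (partial_deriv 3 BL_param (x s)) (\<gamma>' s)) has_real_derivative 0) (at s0 within {0..1})"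
      using laws(2)[of 3] by simp
    have rot: "partial_deriv 3 BL_param (x s) = axial_rotation (\<gamma> s)" if "s \<in> {0..1}" "dist s s0 < e" for s
    proof -
      have "\<gamma> s = BL_param (x s)" using x[OF that] by simp
      then show ?thesis by (simp add: partial_deriv_BL_param axial_rotation_def BL_param_def)
    qed
    have "((\<lambda>s. kerr_metric m a (\<gamma> s) (axial_rotation (\<gamma> s)) (\<gamma>' s)) has_real_derivative 0) (at s0 within {0..1})"
      by (rule has_field_derivative_transform_within[OF L e s0]) (simp only: rot)
    then show ?thesis using laws(1,3-5) by blast
  next
    case True
    define \<sigma> where "\<sigma> = n $ 3"
    have "\<sigma>\<^sup>2 = 1" using n True by (simp add: \<sigma>_def)
    then have \<sigma>: "\<sigma> = 1 \<or> \<sigma> = -1" by (simp add: power2_eq_1_iff)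
    define V where "V = {p :: point. \<sigma> * snd (snd p) $ 3 > 0}"
    have "open V" unfolding V_def by (intro open_Collect_less continuous_intros nth)
    have "\<gamma> s0 \<in> V" using \<open>\<sigma>\<^sup>2 = 1\<close> by (simp add: V_def trn \<sigma>_def power2_eq_square)
    have V: "\<gamma> s \<in> polar_param \<sigma> ` polar_domain" if s: "s \<in> {0..1}" "\<gamma> s \<in> V" for s
    proof -
      obtain t' r' n' where p: "\<gamma> s = (t', r', n')" by (cases "\<gamma> s")
      have "norm n' = 1" using kerr_spacetimeD(1)[OF sp[OF s(1)]] by (simp add: p)
      then have n': "(n' $ 1)\<^sup>2 + (n' $ 2)\<^sup>2 + (n' $ 3)\<^sup>2 = 1"
        by (simp add: norm_eq_1 inner_vec_def sum_3 power2_eq_square)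
      have pos: "\<sigma> * n' $ 3 > 0" using s(2) by (simp add: V_def p)
      have "1 - (n' $ 1)\<^sup>2 - (n' $ 2)\<^sup>2 = (\<sigma> * n' $ 3)\<^sup>2"
        using n' \<open>\<sigma>\<^sup>2 = 1\<close> by (simp add: power_mult_distrib)
      then have "sqrt (1 - (n' $ 1)\<^sup>2 - (n' $ 2)\<^sup>2) = \<sigma> * n' $ 3" using pos by simp
      then have "(t', r', n') = polar_param \<sigma> (vector [r', n' $ 1, n' $ 2, t'])"
        using \<sigma> by (auto simp: polar_param_def vec_eq_iff forall_3)
      moreover have "vector [r', n' $ 1, n' $ 2, t'] \<in> polar_domain"
      proof -
        have "n' $ 3 \<noteq> 0" using pos by auto
        then have "(n' $ 3)\<^sup>2 > 0" by simp
        then have "(n' $ 1)\<^sup>2 + (n' $ 2)\<^sup>2 < 1" using n' by linarith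
        then show ?thesis by (simp add: polar_domain_def)
      qed
      ultimately show ?thesis unfolding p by blast
    qed
    have chart: "(polar_domain, polar_param \<sigma>) \<in> kerr_atlas" using \<sigma> by (auto simp: kerr_atlas_def)
    have inv: "invertible (metric_components (kerr_metric m a) (polar_param \<sigma>) y)"
      if "polar_param \<sigma> y = \<gamma> s0" for y
    proof (rule polar_invertible[OF _ _ \<sigma> fast])
      have "snd (snd (polar_param \<sigma> y)) $ 1 = n $ 1" "snd (snd (polar_param \<sigma> y)) $ 2 = n $ 2"
        using that by (simp_all add: trn)
      then show "y $ 2 = 0" "y $ 3 = 0" using True by (simp_all add: polar_param_def)
    qed
    have frame: "partial_deriv k (polar_param \<sigma>) (y + h *\<^sub>R axis 1 1) = partial_deriv k (polar_param \<sigma>) y"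
       "partial_deriv k (polar_param \<sigma>) (y + h *\<^sub>R axis 4 1) = partial_deriv k (polar_param \<sigma>) y"
      if "y \<in> polar_domain" for y h k
    proof -
      have "y + h *\<^sub>R axis 1 1 \<in> polar_domain" "y + h *\<^sub>R axis 4 1 \<in> polar_domain"
        using that by (simp_all add: polar_domain_def)
      note P = partial_deriv_polar_param[OF this(1)] partial_deriv_polar_param[OF this(2)] partial_deriv_polar_param[OF that]
      show "partial_deriv k (polar_param \<sigma>) (y + h *\<^sub>R axis 1 1) = partial_deriv k (polar_param \<sigma>) y"
       "partial_deriv k (polar_param \<sigma>) (y + h *\<^sub>R axis 4 1) = partial_deriv k (polar_param \<sigma>) y"
        using exhaust_4[of k] by (auto simp: P)
    qed
    obtain x v e where e: "e > 0"
      and x: "\<And>s. s \<in> {0..1} \<Longrightarrow> dist s s0 < e \<Longrightarrow> x s \<in> polar_domain \<and> polar_param \<sigma> (x s) = \<gamma> s"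
      and xv: "\<And>s. s \<in> {0..1} \<Longrightarrow> dist s s0 < e \<Longrightarrow> (x has_vector_derivative v s) (at s within {0..1})"
      and vel: "\<gamma>' s0 = (\<Sum>k\<in>UNIV. v s0 $ k *\<^sub>R partial_deriv k (polar_param \<sigma>) (x s0))"
      and laws: "(\<gamma> has_vector_derivative \<gamma>' s0) (at s0 within {0..1})"
    "\<And>l. ((\<lambda>s. kerr_metric m a (\<gamma> s) (partial_deriv l (polar_param \<sigma>) (x s)) (\<gamma>' s)) has_real_derivative
       (\<Sum>i\<in>UNIV. \<Sum>j\<in>UNIV. partial_deriv l (\<lambda>y. metric_components (kerr_metric m a) (polar_param \<sigma>) y $ i $ j) (x s0) * v s0 $ i * v s0 $ j) / 2)
         (at s0 within {0..1})"
    "((\<lambda>s. kerr_metric m a (\<gamma> s) (1, 0, 0) (\<gamma>' s)) has_real_derivative 0) (at s0 within {0..1})"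
    "((\<lambda>s. kerr_metric m a (\<gamma> s) (0, 1, 0) (\<gamma>' s)) has_real_derivative
        kerr_metric_dr m a (\<gamma> s0) (\<gamma>' s0) (\<gamma>' s0) / 2) (at s0 within {0..1})"
    "((\<lambda>s. kerr_metric m a (\<gamma> s) (\<gamma>' s) (\<gamma>' s)) has_real_derivative 0) (at s0 within {0..1})"
      unfolding \<gamma>'_def
      by (rule kerr_geodesic_laws_in_chart[OF geo fast chart s0 \<open>open V\<close> \<open>\<gamma> s0 \<in> V\<close> V polar_param_differentiable
          partial_deriv_polar_param_differentiable inv open_polar_domain norm_polar_param[OF _ \<sigma>] polar_param_shift frame
          partial_deriv_polar_param(1) partial_deriv_polar_param(4)], assumption+) (rule that[unfolded \<gamma>'_def]; assumption)
    define P where "P l s = kerr_metric m a (\<gamma> s) (partial_deriv l (polar_param \<sigma>) (x s)) (\<gamma>' s)" for l s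
    have "\<exists>d. (P l has_real_derivative d) (at s0 within {0..1})" for l
      unfolding P_def by (rule exI) (rule laws(2))
    then obtain d2 d3 where d: "(P 2 has_real_derivative d2) (at s0 within {0..1})"
        "(P 3 has_real_derivative d3) (at s0 within {0..1})" by meson
    have x_comp: "((\<lambda>s. x s $ i) has_real_derivative v s0 $ i) (at s0 within {0..1})" for i
      using bounded_linear.has_vector_derivative[OF bounded_linear_vec_nth xv[OF s0]] e
      by (simp add: has_real_derivative_iff_has_vector_derivative)
    have x0: "x s0 \<in> polar_domain" "polar_param \<sigma> (x s0) = (t, r, n)" using x[OF s0] e trn by auto
    have "snd (snd (polar_param \<sigma> (x s0))) $ 1 = 0" "snd (snd (polar_param \<sigma> (x s0))) $ 2 = 0"
      using True by (simp_all add: x0)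
    then have x23: "x s0 $ 2 = 0" "x s0 $ 3 = 0" by (simp_all add: polar_param_def)
    note F = partial_deriv_polar_param[OF x0(1), of \<sigma>, unfolded x23, simplified]
    have az: "azimuth_form n w = 0" for w using True by (simp add: azimuth_form_def)
    have \<gamma>'0: "\<gamma>' s0 = (v s0 $ 4, v s0 $ 1, vector [v s0 $ 2, v s0 $ 3, 0])"
      by (simp add: vel sum_4 F vec_eq_iff forall_3)
    have P23: "P 2 s0 = (r\<^sup>2 + a\<^sup>2 * (n $ 3)\<^sup>2) * v s0 $ 2" "P 3 s0 = (r\<^sup>2 + a\<^sup>2 * (n $ 3)\<^sup>2) * v s0 $ 3"
      unfolding P_def trn \<gamma>'0 F kerr_metric_dragging_form[OF n1] az by (simp_all add: inner_vec_def sum_3)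
    \<comment> \<open>The unknown derivatives \<open>d2\<close> and \<open>d3\<close> are multiplied
      by coordinates that vanish at \<open>s0\<close>. The remaining terms cancel because on the
      axis \<open>P 2\<close> and \<open>P 3\<close> are the same multiple \<lambda> of the velocity
      components.\<close>
    have "((\<lambda>s. x s $ 2 * P 3 s - x s $ 3 * P 2 s) has_real_derivative
      (v s0 $ 2 * P 3 s0 + d3 * x s0 $ 2) - (v s0 $ 3 * P 2 s0 + d2 * x s0 $ 3)) (at s0 within {0..1})"
      by (intro DERIV_diff DERIV_mult x_comp d)
    then have L: "((\<lambda>s. x s $ 2 * P 3 s - x s $ 3 * P 2 s) has_real_derivative 0) (at s0 within {0..1})"
      by (simp add: x23 P23)
    have rot: "x s $ 2 * P 3 s - x s $ 3 * P 2 s = kerr_metric m a (\<gamma> s) (axial_rotation (\<gamma> s)) (\<gamma>' s)"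
      if "s \<in> {0..1}" "dist s s0 < e" for s
    proof -
      have lin: "linear (\<lambda>u. kerr_metric m a (\<gamma> s) u (\<gamma>' s))"
        using bilinear_kerr_metric[of m a "\<gamma> s"] unfolding bilinear_def by blast
      have "\<gamma> s = polar_param \<sigma> (x s)" "x s \<in> polar_domain" using x[OF that] by simp_all
      then have "axial_rotation (\<gamma> s) = x s $ 2 *\<^sub>R partial_deriv 3 (polar_param \<sigma>) (x s) - x s $ 3 *\<^sub>R partial_deriv 2 (polar_param \<sigma>) (x s)"
        by (simp add: partial_deriv_polar_param axial_rotation_def polar_param_def vec_eq_iff forall_3)
      then show ?thesis by (simp add: P_def linear_diff[OF lin] linear_scale[OF lin])
    qed
    have "((\<lambda>s. kerr_metric m a (\<gamma> s) (axial_rotation (\<gamma> s)) (\<gamma>' s)) has_real_derivative 0) (at s0 within {0..1})"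
      by (rule has_field_derivative_transform_within[OF L e s0 rot])
    then show ?thesis using laws(1,3-5) by blast
  qed
qed

section \<open>Geodesics of zero angular momentum\<close>

text \<open>The projection of a geodesic of zero angular momentum to t, r and c = cos \<theta>.
  \<open>radial_force\<close> says that \<lambda> (\<lambda> r')' is half the r-derivative of the
  right-hand side of \<open>r_eq\<close>. It is kept beside \<open>r_eq\<close> because the squared
  equation does not determine the acceleration where r' = 0.\<close>

locale separated_motion =
  fixes m a E C K :: real and t r c t' r' c' :: "real \<Rightarrow> real"
  assumes m_pos: "m > 0" and fast: "a\<^sup>2 > m\<^sup>2"
    and t_deriv: "\<And>s. s \<in> {0..1} \<Longrightarrow> (t has_real_derivative t' s) (at s within {0..1})"
    and r_deriv: "\<And>s. s \<in> {0..1} \<Longrightarrow> (r has_real_derivative r' s) (at s within {0..1})"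
    and c_deriv: "\<And>s. s \<in> {0..1} \<Longrightarrow> (c has_real_derivative c' s) (at s within {0..1})"
    and nonsingular: "\<And>s. s \<in> {0..1} \<Longrightarrow> (r s)\<^sup>2 + a\<^sup>2 * (c s)\<^sup>2 > 0"
    and c_le: "\<And>s. s \<in> {0..1} \<Longrightarrow> (c s)\<^sup>2 \<le> 1"
    and t_eq: "\<And>s. s \<in> {0..1} \<Longrightarrow> ((r s)\<^sup>2 + a\<^sup>2 * (c s)\<^sup>2) * t' s =
        E * ((r s)\<^sup>2 + a\<^sup>2 * (c s)\<^sup>2 + 2 * m * r s * ((r s)\<^sup>2 + a\<^sup>2) / kerr_Delta m a (r s))"
    and r_eq: "\<And>s. s \<in> {0..1} \<Longrightarrow> (((r s)\<^sup>2 + a\<^sup>2 * (c s)\<^sup>2) * r' s)\<^sup>2 =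
        E\<^sup>2 * ((r s)\<^sup>2 + a\<^sup>2)\<^sup>2 - kerr_Delta m a (r s) * (K - C * (r s)\<^sup>2)"
    and c_eq: "\<And>s. s \<in> {0..1} \<Longrightarrow> (((r s)\<^sup>2 + a\<^sup>2 * (c s)\<^sup>2) * c' s)\<^sup>2 =
        (1 - (c s)\<^sup>2) * (K - a\<^sup>2 * E\<^sup>2 * (1 - (c s)\<^sup>2) + a\<^sup>2 * C * (c s)\<^sup>2)"
    and radial_force: "\<And>s. s \<in> {0..1} \<Longrightarrow>
        ((\<lambda>s. ((r s)\<^sup>2 + a\<^sup>2 * (c s)\<^sup>2) * r' s) has_real_derivative
          (2 * E\<^sup>2 * r s * ((r s)\<^sup>2 + a\<^sup>2) - (r s - m) * (K - C * (r s)\<^sup>2)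
             + C * r s * kerr_Delta m a (r s)) / ((r s)\<^sup>2 + a\<^sup>2 * (c s)\<^sup>2)) (at s within {0..1})"

context separated_motion
begin

lemma Delta_pos: "kerr_Delta m a x > 0"
  using fast by (rule kerr_Delta_pos)

lemma a_sq_pos: "a\<^sup>2 > 0"
  using fast m_pos by (smt (verit) zero_less_power2)

lemma continuous:
  "continuous_on {0..1} t" "continuous_on {0..1} r" "continuous_on {0..1} c"
  using t_deriv r_deriv c_deriv by (blast intro: DERIV_continuous_on)+

lemma deriv_interior:
  assumes "0 < s" "s < 1"
  shows "(t has_real_derivative t' s) (at s)" "(r has_real_derivative r' s) (at s)"
    "(c has_real_derivative c' s) (at s)"
  using t_deriv[of s] r_deriv[of s] c_deriv[of s] assms by (simp_all add: at_within_Icc_at)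

section \<open>Crossing the equator and the surface r = 0\<close>

lemma equator_crossing:
  assumes "c 0 = 1" "c 1 = -1"
  obtains s where "0 < s" "s < 1" "c s = 0" "a\<^sup>2 * E\<^sup>2 \<le> K"
proof -
  obtain s where s: "0 \<le> s" "s \<le> 1" "c s = 0"
    using IVT2'[of c 1 0 0] continuous(3) assms by auto
  then have "s \<noteq> 0" "s \<noteq> 1" using assms by auto
  have "0 \<le> K - a\<^sup>2 * E\<^sup>2"
    using c_eq[of s] s by (metis (no_types, lifting) add.right_neutral atLeastAtMost_iff diff_zero mult.left_neutral mult.right_neutral mult_zero_right zero_le_power2 zero_power2)
  with that s \<open>s \<noteq> 0\<close> \<open>s \<noteq> 1\<close> show thesis by (metis diff_ge_0_iff_ge less_eq_real_def)
qed

text \<open>Once K = a^2 E^2, the polar equation reads (\<lambda> c')^2 = a^2 (E^2 + C) (1 - c^2)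
  c^2. This bounds |c'| by a multiple of |c|, and by a Gronwall argument c stays zero after the
  crossing at \<open>s0\<close>, against \<open>c 1 = -1\<close>.\<close>

lemma no_ring_passage:
  assumes "c 0 = 1" "c 1 = -1" "r 0 > 0" "r 1 < 0"
  shows False
proof -
  obtain s0 where s0: "0 < s0" "s0 < 1" "c s0 = 0" and ge: "a\<^sup>2 * E\<^sup>2 \<le> K"
    using equator_crossing[OF assms(1,2)] .
  obtain s1 where s1: "s1 \<in> {0..1}" "r s1 = 0"
    using IVT2'[of r 1 0 0] continuous(2) assms(3,4) by auto
  have "0 \<le> E\<^sup>2 * (a\<^sup>2)\<^sup>2 - a\<^sup>2 * K"
    using r_eq[OF s1(1)] s1(2) zero_le_power2[of "((r s1)\<^sup>2 + a\<^sup>2 * (c s1)\<^sup>2) * r' s1"]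
    by (simp add: kerr_Delta_def)
  also have "\<dots> = a\<^sup>2 * (a\<^sup>2 * E\<^sup>2 - K)" by (simp add: algebra_simps power2_eq_square)
  finally have "K \<le> a\<^sup>2 * E\<^sup>2" using a_sq_pos by (simp add: zero_le_mult_iff)
  with ge have K: "K = a\<^sup>2 * E\<^sup>2" by simp
  define l where "l s = (r s)\<^sup>2 + a\<^sup>2 * (c s)\<^sup>2" for s
  have "continuous_on {0..1} l"
    unfolding l_def by (intro continuous_intros continuous)
  \<comment> \<open>A positive minimum of \<lambda> on the compact interval turns the bound on
    \<lambda> c' into a bound on c'.\<close>
  then obtain z where z: "z \<in> {0..1}" "\<And>s. s \<in> {0..1} \<Longrightarrow> l z \<le> l s"
    using continuous_attains_inf[of "{0..1}" l] by auto
  have lz: "l z > 0" using nonsingular[OF z(1)] by (simp add: l_def)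
  define M where "M = sqrt (a\<^sup>2 * \<bar>E\<^sup>2 + C\<bar>) / l z"
  have c'_le: "\<bar>c' s\<bar> \<le> M * \<bar>c s\<bar>" if s: "s \<in> {0..1}" for s
  proof -
    have "(l s * c' s)\<^sup>2 = ((1 - (c s)\<^sup>2) * (E\<^sup>2 + C)) * (a\<^sup>2 * (c s)\<^sup>2)"
      using c_eq[OF s] unfolding l_def K by (simp add: algebra_simps)
    also have "\<dots> \<le> \<bar>E\<^sup>2 + C\<bar> * (a\<^sup>2 * (c s)\<^sup>2)"
    proof (rule mult_right_mono)
      have "(1 - (c s)\<^sup>2) * (E\<^sup>2 + C) \<le> (1 - (c s)\<^sup>2) * \<bar>E\<^sup>2 + C\<bar>"
        using c_le[OF s] by (intro mult_left_mono) auto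
      also have "\<dots> \<le> 1 * \<bar>E\<^sup>2 + C\<bar>" by (intro mult_right_mono) auto
      finally show "(1 - (c s)\<^sup>2) * (E\<^sup>2 + C) \<le> \<bar>E\<^sup>2 + C\<bar>" by simp
    qed simp
    also have "\<dots> = (M * l z * \<bar>c s\<bar>)\<^sup>2"
      using lz by (simp add: M_def power_mult_distrib)
    finally have "\<bar>l s * c' s\<bar> \<le> \<bar>M * l z * \<bar>c s\<bar>\<bar>"
      by (simp add: abs_le_square_iff)
    then have "l s * \<bar>c' s\<bar> \<le> l z * (M * \<bar>c s\<bar>)"
      using lz z(2)[OF s] by (simp add: abs_mult M_def)
    moreover have "l z * \<bar>c' s\<bar> \<le> l s * \<bar>c' s\<bar>"
      by (rule mult_right_mono[OF z(2)[OF s]]) simp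
    ultimately have "l z * \<bar>c' s\<bar> \<le> l z * (M * \<bar>c s\<bar>)" by linarith
    then show ?thesis using lz by simp
  qed
  \<comment> \<open>The exponential weight makes c^2 nonincreasing, because c c' \<le> M
    c^2.\<close>
  define f where "f s = (c s)\<^sup>2 * exp (- 2 * M * s)" for s
  have "f 1 \<le> f s0"
  proof (rule DERIV_nonpos_imp_decreasing_open[where f=f])
    show "continuous_on {s0..1} f"
      unfolding f_def using s0
      by (intro continuous_intros continuous_on_subset[OF continuous(3)]) auto
    fix s assume s: "s0 < s" "s < 1"
    have "(f has_real_derivative (2 * (c s * c' s) - 2 * (M * (c s)\<^sup>2)) * exp (- 2 * M * s)) (at s)"
      unfolding f_def using deriv_interior(3)[of s] s s0
      by (auto intro!: derivative_eq_intros simp: algebra_simps)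
    moreover have "c s * c' s \<le> M * (c s)\<^sup>2"
    proof -
      have "c s * c' s \<le> \<bar>c s\<bar> * \<bar>c' s\<bar>" by (metis abs_ge_self abs_mult)
      also have "\<dots> \<le> \<bar>c s\<bar> * (M * \<bar>c s\<bar>)" using c'_le[of s] s s0 by (intro mult_left_mono) auto
      finally show ?thesis by (simp add: power2_eq_square mult_ac flip: abs_mult)
    qed
    ultimately show "\<exists>y. (f has_real_derivative y) (at s) \<and> y \<le> 0"
      by (intro exI[of _ "(2 * (c s * c' s) - 2 * (M * (c s)\<^sup>2)) * exp (- 2 * M * s)"])
         (simp add: mult_le_0_iff)
  qed (use s0 in simp)
  then show False using s0 assms by (simp add: f_def mult_le_0_iff)
qed

section \<open>Motion of zero energy\<close>

lemma energy_zero: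
  assumes "t 0 = t 1" and r: "\<And>s. s \<in> {0..1} \<Longrightarrow> r s > 0"
  shows "E = 0"
proof -
  \<comment> \<open>By Rolle, t' vanishes somewhere, whereas for r > 0 the factor of
    \<open>E\<close> in \<open>t_eq\<close> is positive.\<close>
  obtain s where s: "0 < s" "s < 1" "t' s = 0"
    using Rolle_deriv[of 0 1 t "\<lambda>s x. t' s * x"] assms(1) continuous(1) deriv_interior(1)
    by (auto simp: has_field_derivative_def fun_eq_iff)
  then have "s \<in> {0..1}" by simp
  have "2 * m * r s * ((r s)\<^sup>2 + a\<^sup>2) / kerr_Delta m a (r s) > 0"
    using m_pos r[of s] Delta_pos s a_sq_pos by (intro divide_pos_pos mult_pos_pos add_nonneg_pos) auto
  then show ?thesis
    using t_eq[OF \<open>s \<in> {0..1}\<close>] nonsingular[OF \<open>s \<in> {0..1}\<close>] s(3) by auto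
qed

text \<open>For \<open>E = 0\<close> the radial equation is (\<lambda> r')^2 = \<triangle> (C r^2 -
  K) with \<triangle> > 0. Its sign gives this bound, and its zeros give the next lemma.\<close>

lemma zero_energy_K_le:
  assumes "E = 0" "s \<in> {0..1}"
  shows "K \<le> C * (r s)\<^sup>2"
proof -
  have "0 \<le> kerr_Delta m a (r s) * (C * (r s)\<^sup>2 - K)"
    using r_eq[OF assms(2)] zero_le_power2[of "((r s)\<^sup>2 + a\<^sup>2 * (c s)\<^sup>2) * r' s"] assms(1)
    by (simp add: right_diff_distrib)
  then show ?thesis using Delta_pos[of "r s"] by (simp add: zero_le_mult_iff)
qed

lemma zero_energy_turning:
  assumes "E = 0" "s \<in> {0..1}" "r' s = 0"
  shows "K = C * (r s)\<^sup>2"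
  using r_eq[OF assms(2)] assms Delta_pos[of "r s"] by simp

text \<open>The geodesic has to be spacelike. At the equator 0 \<le> K \<le> C r^2 with r nonzero,
  so C \<ge> 0. If C = 0, then K = 0 as well, and the polar equation makes c constant.\<close>

lemma zero_energy_C_pos:
  assumes "E = 0" "c 0 = 1" "c 1 = -1"
  shows "C > 0"
proof -
  obtain s where s: "0 < s" "s < 1" "c s = 0" and K: "0 \<le> K"
    using equator_crossing[OF assms(2,3)] assms(1) by auto
  have "r s \<noteq> 0" using nonsingular[of s] s by auto
  then have "C \<ge> 0" using zero_energy_K_le[of s] K s assms(1)
    by (smt (verit) atLeastAtMost_iff mult_neg_pos zero_less_power2)
  moreover have "C \<noteq> 0"
  proof
    assume C: "C = 0"
    then have "K = 0" using zero_energy_K_le[of s] K s assms(1) by auto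
    then have "c' s = 0" if "s \<in> {0..1}" for s
      using c_eq[OF that] nonsingular[OF that] C assms(1) by simp
    then have "(c has_real_derivative 0) (at s within {0..1})" if "s \<in> {0..1}" for s
      using c_deriv[OF that] that by simp
    then obtain k where "\<And>s. s \<in> {0..1} \<Longrightarrow> c s = k"
      using has_field_derivative_zero_constant[of "{0..1}" c] by auto
    then show False using assms(2,3)
      by (metis atLeastAtMost_iff equal_neg_zero order_refl zero_le_one zero_neq_one)
  qed
  ultimately show ?thesis by simp
qed

text \<open>At an interior maximum of r the radial velocity vanishes, so K equals C times the square
  of that maximum, while the starting point gives K \<le> C r0^2.\<close>

lemma zero_energy_r_le:
  assumes "E = 0" "c 0 = 1" "c 1 = -1" "r 0 = r0" "r 1 = r0" "r0 > 0" "s \<in> {0..1}"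
  shows "r s \<le> r0"
proof (rule ccontr)
  assume "\<not> r s \<le> r0"
  obtain z where z: "z \<in> {0..1}" "\<And>s. s \<in> {0..1} \<Longrightarrow> r s \<le> r z"
    using continuous_attains_sup[of "{0..1}" r] continuous(2) by auto
  have rz: "r z > r0" using z(2)[OF assms(7)] \<open>\<not> r s \<le> r0\<close> by simp
  then have "z \<noteq> 0" "z \<noteq> 1" using assms by auto
  with z have z01: "0 < z" "z < 1" by auto
  have "r' z = 0"
    using DERIV_local_max[OF deriv_interior(2)[OF z01], of "min z (1 - z)"] z z01
    by (auto simp: abs_if split: if_splits)
  then have "C * (r z)\<^sup>2 \<le> C * r0\<^sup>2"
    using zero_energy_turning[OF assms(1) z(1)] zero_energy_K_le[OF assms(1), of 0] assms(4) by simp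
  then have "(r z)\<^sup>2 \<le> r0\<^sup>2"
    using zero_energy_C_pos[OF assms(1-3)] by simp
  then show False using rz assms(6) by (smt (verit) power2_le_imp_le)
qed

text \<open>
  The radial momentum \<open>\<lambda> r'\<close> grows at least proportionally to the decrease of \<open>c\<close>, but it is small
  at both ends because \<open>r\<close> is close to its minimum there.
\<close>

lemma zero_energy_long_return:
  fixes \<nu> r0 :: real
  defines "\<kappa> \<equiv> \<nu> * (a\<^sup>2 - m\<^sup>2) / 2" and "D \<equiv> (\<nu> + 1)\<^sup>2 + a\<^sup>2"
  assumes E: "E = 0" and c: "c 0 = 1" "c 1 = -1" and r0: "r 0 = r0" "r 1 = r0"
    and \<nu>: "0 < \<nu>" "r0 \<le> \<nu> + 1" "m * (r0\<^sup>2 - \<nu>\<^sup>2) \<le> \<kappa>" "D\<^sup>2 * (r0\<^sup>2 - \<nu>\<^sup>2) < \<kappa>\<^sup>2"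
    and r: "\<And>s. s \<in> {0..1} \<Longrightarrow> r s > \<nu>"
  shows False
proof -
  define \<delta> where "\<delta> = r0\<^sup>2 - \<nu>\<^sup>2"
  have C: "C > 0" using zero_energy_C_pos[OF E c] .
  have "r0 > \<nu>" using r[of 0] r0 by simp
  have r_le: "r s \<le> r0" if "s \<in> {0..1}" for s
    using zero_energy_r_le[OF E c r0] \<open>r0 > \<nu>\<close> \<nu>(1) that by simp
  have \<kappa>: "\<kappa> > 0" using \<nu>(1) fast by (simp add: \<kappa>_def)
  have D: "D > 0" using a_sq_pos by (simp add: D_def add_nonneg_pos)
  \<comment> \<open>As the end radii agree, there is a turning point, and its radius exceeds
    \<open>\<nu>\<close>. This bounds \<open>K\<close> from below and hence C r^2 - K from above by
    C \<delta> on the whole curve.\<close>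
  obtain z where z: "0 < z" "z < 1" "r' z = 0"
    using Rolle_deriv[of 0 1 r "\<lambda>s x. r' s * x"] r0 continuous(2) deriv_interior(2)
    by (auto simp: has_field_derivative_def fun_eq_iff)
  then have K: "K > C * \<nu>\<^sup>2"
    using zero_energy_turning[OF E, of z] r[of z] C \<nu>(1) by (simp add: power_strict_mono)
  have CrK: "0 \<le> C * (r s)\<^sup>2 - K" "C * (r s)\<^sup>2 - K \<le> C * \<delta>" if "s \<in> {0..1}" for s
  proof -
    show "0 \<le> C * (r s)\<^sup>2 - K" using zero_energy_K_le[OF E that] by simp
    have "(r s)\<^sup>2 \<le> r0\<^sup>2" using r_le[OF that] r[OF that] \<nu>(1) by (intro power_mono) auto
    then have "C * (r s)\<^sup>2 \<le> C * r0\<^sup>2" using C by simp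
    then show "C * (r s)\<^sup>2 - K \<le> C * \<delta>" using K by (simp add: \<delta>_def algebra_simps)
  qed
  \<comment> \<open>The weight is chosen so that g |\<lambda> c'| \<le> C \<kappa>, given the bound
    |\<lambda> c'| \<le> sqrt (C D) proved below.\<close>
  define g where "g = \<kappa> * sqrt C / sqrt D"
  have g: "g > 0" using C D \<kappa> by (simp add: g_def)
  define y where "y s = ((r s)\<^sup>2 + a\<^sup>2 * (c s)\<^sup>2) * r' s" for s
  define y' where "y' s = ((r s - m) * (C * (r s)\<^sup>2 - K) + C * r s * kerr_Delta m a (r s))
      / ((r s)\<^sup>2 + a\<^sup>2 * (c s)\<^sup>2)" for s
  have y_deriv: "(y has_real_derivative y' s) (at s within {0..1})" if "s \<in> {0..1}" for s
    using radial_force[OF that] E unfolding y_def y'_def by (simp add: algebra_simps)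
  have "y 0 + g * c 0 \<le> y 1 + g * c 1"
  proof (rule DERIV_nonneg_imp_increasing_open[where f="\<lambda>s. y s + g * c s"])
    show "continuous_on {0..1} (\<lambda>s. y s + g * c s)"
      using y_deriv by (intro continuous_intros continuous DERIV_continuous_on)
    fix s :: real assume s01: "0 < s" "s < 1"
    then have s: "s \<in> {0..1}" by simp
    define l where "l = (r s)\<^sup>2 + a\<^sup>2 * (c s)\<^sup>2"
    have l: "l > 0" using nonsingular[OF s] by (simp add: l_def)
    have "((\<lambda>s. y s + g * c s) has_real_derivative y' s + g * c' s) (at s)"
      using y_deriv[OF s] deriv_interior(3)[OF s01] s01
      by (auto intro!: derivative_eq_intros simp: at_within_Icc_at)
    moreover have "0 \<le> y' s + g * c' s"
    proof -
      have "K \<le> C * (\<nu> + 1)\<^sup>2"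
      proof -
        have "K \<le> C * r0\<^sup>2" using zero_energy_K_le[OF E, of 0] r0 by simp
        also have "\<dots> \<le> C * (\<nu> + 1)\<^sup>2"
          using C \<open>r0 > \<nu>\<close> \<nu> by (intro mult_left_mono power_mono) auto
        finally show ?thesis .
      qed
      have "(l * c' s)\<^sup>2 = (1 - (c s)\<^sup>2) * (K + a\<^sup>2 * C * (c s)\<^sup>2)"
        using c_eq[OF s] E by (simp add: l_def)
      also have "\<dots> \<le> 1 * (C * (\<nu> + 1)\<^sup>2 + a\<^sup>2 * C * 1)"
      proof (intro mult_mono add_mono)
        have "0 < C * \<nu>\<^sup>2" using C \<nu> by simp
        then show "0 \<le> K + a\<^sup>2 * C * (c s)\<^sup>2"
          using K C by (intro add_nonneg_nonneg mult_nonneg_nonneg) auto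
      qed (use C c_le[OF s] \<open>K \<le> C * (\<nu> + 1)\<^sup>2\<close> in auto)
      also have "\<dots> = (sqrt C * sqrt D)\<^sup>2"
        using C D by (simp add: power_mult_distrib) (simp add: D_def algebra_simps)
      finally have "\<bar>l * c' s\<bar> \<le> sqrt C * sqrt D"
        using C D by (simp flip: abs_le_square_iff)
      then have "- (sqrt C * sqrt D) \<le> l * c' s" by linarith
      then have "g * - (sqrt C * sqrt D) \<le> g * (l * c' s)"
        using g by (intro mult_left_mono) auto
      moreover have "g * (sqrt C * sqrt D) = C * \<kappa>"
        using C D by (simp add: g_def)
      ultimately have 1: "- (C * \<kappa>) \<le> g * (l * c' s)" by simp
      \<comment> \<open>The factor r - m may be negative, but it is at least -m, and C r^2 - K lies
        between 0 and C \<delta>.\<close>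
      have "- (m * (C * \<delta>)) \<le> (- m) * (C * (r s)\<^sup>2 - K)"
        using CrK[OF s] m_pos by simp
      also have "\<dots> \<le> (r s - m) * (C * (r s)\<^sup>2 - K)"
        using CrK[OF s] r[OF s] \<nu>(1) by (intro mult_right_mono) auto
      finally have 2: "- (m * (C * \<delta>)) \<le> (r s - m) * (C * (r s)\<^sup>2 - K)" .
      have "C * (m * \<delta>) \<le> C * \<kappa>" using C \<nu>(3) by (simp add: \<delta>_def)
      \<comment> \<open>The left-hand side is 2 \<kappa>. One half of this force absorbs the
        possibly negative term above, the other half the polar term g \<lambda> c'.\<close>
      have "\<nu> * (a\<^sup>2 - m\<^sup>2) \<le> r s * kerr_Delta m a (r s)"
        using r[OF s] \<nu>(1) fast unfolding kerr_Delta_eq by (intro mult_mono) auto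
      then have "C * (2 * \<kappa>) \<le> C * (r s * kerr_Delta m a (r s))"
        using C by (simp add: \<kappa>_def)
      then have "0 \<le> (r s - m) * (C * (r s)\<^sup>2 - K) + C * r s * kerr_Delta m a (r s) + g * (l * c' s)"
        using 1 2 \<open>C * (m * \<delta>) \<le> C * \<kappa>\<close> by (simp add: algebra_simps)
      also have "(r s - m) * (C * (r s)\<^sup>2 - K) + C * r s * kerr_Delta m a (r s) = l * y' s"
        using l unfolding y'_def l_def[symmetric] by (metis less_irrefl nonzero_mult_div_cancel_left times_divide_eq_right)
      also have "l * y' s + g * (l * c' s) = l * (y' s + g * c' s)"
        by (simp add: algebra_simps)
      finally show ?thesis using l by (simp add: zero_le_mult_iff)
    qed
    ultimately show "\<exists>d. ((\<lambda>s. y s + g * c s) has_real_derivative d) (at s) \<and> 0 \<le> d" by blast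
  qed simp
  \<comment> \<open>The value of c drops by 2 from one pole to the other, so the radial momentum has
    to gain at least 2 g.\<close>
  then have "2 * g \<le> y 1 - y 0" using c by simp
  moreover have "\<bar>y s\<bar> < g" if s: "s = 0 \<or> s = 1" for s
  proof -
    have s01: "s \<in> {0..1}" using s by auto
    have rs: "r s = r0" using s r0 by auto
    have "kerr_Delta m a r0 \<le> D"
    proof -
      have "r0\<^sup>2 \<le> (\<nu> + 1)\<^sup>2" using \<nu> \<open>r0 > \<nu>\<close> by (intro power_mono) auto
      moreover have "m * r0 > 0" using m_pos \<nu> \<open>r0 > \<nu>\<close> by simp
      ultimately show ?thesis by (simp add: kerr_Delta_def D_def)
    qed
    \<comment> \<open>At the end points the radial equation makes y^2 at most D C \<delta>, and the
      last smallness condition on \<open>r0\<close> puts this below g^2 = \<kappa>^2 C / D.\<close>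
    have "(y s)\<^sup>2 = kerr_Delta m a r0 * (C * (r s)\<^sup>2 - K)"
      using r_eq[OF s01] E rs by (simp add: y_def algebra_simps)
    also have "\<dots> \<le> D * (C * \<delta>)"
      using CrK[OF s01] \<open>kerr_Delta m a r0 \<le> D\<close> D by (intro mult_mono) auto
    also have "\<dots> < g\<^sup>2"
    proof -
      have "D * (C * \<delta>) = D\<^sup>2 * \<delta> * C / D" using D by (simp add: power2_eq_square)
      also have "\<dots> < \<kappa>\<^sup>2 * C / D"
        using \<nu>(4) C D by (intro divide_strict_right_mono mult_strict_right_mono) (auto simp: \<delta>_def)
      also have "\<dots> = g\<^sup>2" using C D by (simp add: g_def power_mult_distrib power_divide)
      finally show ?thesis .
    qed
    finally have "\<bar>y s\<bar> < \<bar>g\<bar>" using abs_le_square_iff[of g "y s"] by linarith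
    then show ?thesis using g by simp
  qed
  from this[of 0] this[of 1] have "y 1 - y 0 < 2 * g" by linarith
  ultimately show False by simp
qed

end

section \<open>Separation of the geodesic equation\<close>

text \<open>
  Here \<open>S = sin\<^sup>2\<theta>\<close>, \<open>w\<close> is the azimuthal velocity form and \<open>N\<close> the squared angular speed. The
  third identity is \<open>\<lambda> (\<lambda> r')'\<close>, with the radial geodesic equation inserted for \<open>(\<lambda> r' / \<triangle>)'\<close>.
\<close>

lemma separation_identities:
  fixes E C m a r l S u w b t' r' N c' D A :: real
  assumes A: "A = r\<^sup>2 + a\<^sup>2" and l: "l = A - a\<^sup>2 * S" and D: "D = A - 2 * m * r" and b: "b * l = 2 * m * r"
    and pos: "l > 0" "D > 0" "A > 0"
    and u: "u = t' - a * w" and E: "t' - b * u = E" and L: "A * w = a * b * S * u"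
    and C: "C = - t'\<^sup>2 + a\<^sup>2 * w\<^sup>2 + b * u\<^sup>2 + l / D * r'\<^sup>2 + l * N" and N: "S * N = c'\<^sup>2 + w\<^sup>2"
  shows "l * t' = E * (l + 2 * m * r * A / D)"
    and "(l * c')\<^sup>2 = S * ((E\<^sup>2 * A\<^sup>2 - (l * r')\<^sup>2) / D + C * r\<^sup>2 - a\<^sup>2 * E\<^sup>2 * S + a\<^sup>2 * C * (1 - S))"
    and "l * (2 * (r - m) * r' * (l / D * r') + D * ((2 * m * (l - 2 * r\<^sup>2) / l\<^sup>2 * u\<^sup>2
            + (2 * r / D - 2 * (r - m) * l / D\<^sup>2) * r'\<^sup>2 + 2 * r * N) / 2))
        = 2 * E\<^sup>2 * r * A - (r - m) * ((E\<^sup>2 * A\<^sup>2 - (l * r')\<^sup>2) / D) + C * r * D"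
proof -
  \<comment> \<open>Energy and vanishing angular momentum form a linear system for t' and w. Its
    solution is u = E A / D, w = a b S E / D and t' = E + b E A / D.\<close>
  have uD: "u * D = E * A" using A l D b u E L by algebra
  have "A * (w * D) = A * (a * b * S * E)" using uD L by algebra
  then have wD: "w * D = a * b * S * E" using pos by simp
  have tD: "t' * D = E * D + b * (E * A)" using uD E by algebra
  \<comment> \<open>\<open>T\<close> is minus the contribution of t' and w to \<open>C\<close>, so C
    + T is the part due to r' and \<open>N\<close>.\<close>
  define T where "T = t'\<^sup>2 - a\<^sup>2 * w\<^sup>2 - b * u\<^sup>2"
  have "T * D\<^sup>2 = (t' * D)\<^sup>2 - a\<^sup>2 * (w * D)\<^sup>2 - b * (u * D)\<^sup>2"
    unfolding T_def by algebra
  also have "\<dots> = E\<^sup>2 * A * (A + b * A - 2 * b * l)"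
    unfolding tD wD uD using l D b by algebra
  finally have TD: "T * D\<^sup>2 = E\<^sup>2 * A * (A + b * A - 2 * b * l)" .
  \<comment> \<open>Named reciprocals, here of \<open>D\<close> and below of \<open>l\<close>, turn
    the remaining claims into polynomial identities.\<close>
  define i where "i = 1 / D"
  have i: "i * D = 1" using pos by (simp add: i_def)
  have divD: "x / D = x * i" for x by (simp add: i_def)
  have CN: "l * N = C + T - l * i * r'\<^sup>2"
    unfolding C T_def divD by algebra
  show "l * t' = E * (l + 2 * m * r * A / D)"
    unfolding divD using tD i b by algebra
  have "T * D = T * D\<^sup>2 * i" using i by algebra
  then have TD1: "T * D = E\<^sup>2 * A * (A + b * A - 2 * b * l) * i" unfolding TD .
  have T: "T = E\<^sup>2 * A * (A + b * A - 2 * b * l) * i\<^sup>2" using TD1 i by algebra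
  have w: "w = a * b * S * E * i" using wD i by algebra
  have "(l * c')\<^sup>2 = S * l * (l * N) - (l * w)\<^sup>2" using N by algebra
  also have "\<dots> = S * ((E\<^sup>2 * A\<^sup>2 - (l * r')\<^sup>2) * i + C * r\<^sup>2 - a\<^sup>2 * E\<^sup>2 * S + a\<^sup>2 * C * (1 - S))"
  proof -
    have "S * l * T - (l * w)\<^sup>2 = S * (E\<^sup>2 * A\<^sup>2 * i - a\<^sup>2 * E\<^sup>2 * S)"
      unfolding T w using i l D b by algebra
    then show ?thesis unfolding CN using l A by algebra
  qed
  finally show "(l * c')\<^sup>2 = S * ((E\<^sup>2 * A\<^sup>2 - (l * r')\<^sup>2) / D + C * r\<^sup>2 - a\<^sup>2 * E\<^sup>2 * S + a\<^sup>2 * C * (1 - S))"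
    unfolding divD .
  define j where "j = 1 / l"
  have j: "j * l = 1" using pos by (simp add: j_def)
  have divl: "x / l\<^sup>2 = x * j\<^sup>2" "x / D\<^sup>2 = x * i\<^sup>2" for x by (simp_all add: j_def i_def power_divide)
  have bj: "b = 2 * m * r * j" using b j by algebra
  have u': "u = E * A * i" using uD i by algebra
  \<comment> \<open>Here the dependence on the polar angle cancels: the right-hand side involves
    only the radius and the energy. This is what separates the radial equation.\<close>
  have F: "r * T * D + (m - b * r) * u\<^sup>2 * D = 2 * E\<^sup>2 * r * A - (r - m) * E\<^sup>2 * A\<^sup>2 * i"
    unfolding T u' using i l D b by algebra
  have "l * (2 * (r - m) * r' * (l * i * r') + D * ((2 * m * (l - 2 * r\<^sup>2) * j\<^sup>2 * u\<^sup>2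
            + (2 * r * i - 2 * (r - m) * l * i\<^sup>2) * r'\<^sup>2 + 2 * r * N) * (1 / 2)))
     = (r - m) * (l * r')\<^sup>2 * i + l * r * r'\<^sup>2 + (m - b * r) * u\<^sup>2 * D + D * r * (l * N)"
    unfolding bj using i j by algebra
  also have "\<dots> = (r - m) * (l * r')\<^sup>2 * i + C * r * D + (r * T * D + (m - b * r) * u\<^sup>2 * D)"
    unfolding CN using i by algebra
  also have "\<dots> = 2 * E\<^sup>2 * r * A - (r - m) * ((E\<^sup>2 * A\<^sup>2 - (l * r')\<^sup>2) * i) + C * r * D"
    unfolding F by algebra
  finally show "l * (2 * (r - m) * r' * (l / D * r') + D * ((2 * m * (l - 2 * r\<^sup>2) / l\<^sup>2 * u\<^sup>2
            + (2 * r / D - 2 * (r - m) * l / D\<^sup>2) * r'\<^sup>2 + 2 * r * N) / 2))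
        = 2 * E\<^sup>2 * r * A - (r - m) * ((E\<^sup>2 * A\<^sup>2 - (l * r')\<^sup>2) / D) + C * r * D"
    unfolding divl divD by simp
qed

text \<open>In spherical coordinates both sides are sin^2 \<theta> (\<theta>'^2 + sin^2 \<theta>
  \<phi>'^2). The vector form holds on the axis as well.\<close>

lemma sphere_tangent_identity:
  fixes n w :: "real^3"
  assumes "n \<bullet> n = 1" "n \<bullet> w = 0"
  shows "(1 - (n $ 3)\<^sup>2) * (w \<bullet> w) = (w $ 3)\<^sup>2 + (azimuth_form n w)\<^sup>2"
  using assms unfolding inner_vec_def sum_3 azimuth_form_def inner_real_def by algebra

lemma derivative_norm_1:
  fixes n n' :: "real \<Rightarrow> 'a::real_inner"
  assumes "\<And>s. s \<in> {0..1} \<Longrightarrow> norm (n s) = 1" "s \<in> {0..1}"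
    "(n has_vector_derivative n' s) (at s within {0..1})"
  shows "n s \<bullet> n' s = 0"
proof -
  have "((\<lambda>s. n s \<bullet> n s) has_derivative (\<lambda>h. n s \<bullet> (h *\<^sub>R n' s) + (h *\<^sub>R n' s) \<bullet> n s)) (at s within {0..1})"
    by (rule has_derivative_inner[OF assms(3)[unfolded has_vector_derivative_def] assms(3)[unfolded has_vector_derivative_def]])
  then have "((\<lambda>s. n s \<bullet> n s) has_vector_derivative 2 * (n s \<bullet> n' s)) (at s within {0..1})"
    unfolding has_vector_derivative_def by (simp add: inner_commute algebra_simps)
  then have 1: "vector_derivative (\<lambda>s. n s \<bullet> n s) (at s within {0..1}) = 2 * (n s \<bullet> n' s)"
    using assms(2) by (intro vector_derivative_within_cbox[of 0 1, simplified]) auto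
  have "((\<lambda>s. n s \<bullet> n s) has_vector_derivative 0) (at s within {0..1})"
  proof (rule has_vector_derivative_transform[OF assms(2)])
    show "((\<lambda>_. 1::real) has_vector_derivative 0) (at s within {0..1})" by simp
    show "n s \<bullet> n s = 1" if "s \<in> {0..1}" for s using assms(1)[OF that] by (simp add: norm_eq_1)
  qed
  then have 2: "vector_derivative (\<lambda>s. n s \<bullet> n s) (at s within {0..1}) = 0"
    using assms(2) by (intro vector_derivative_within_cbox[of 0 1, simplified]) auto
  show ?thesis using 1 2 by simp
qed

text \<open>The integrals \<open>E\<close>, \<open>C\<close> and the vanishing angular momentum
  eliminate t' and the angular speeds. The radial geodesic equation then yields Carter's constant as
  a further first integral, and the polar equation follows algebraically from it and
  \<open>C\<close>, without the geodesic equation for \<theta>.\<close>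

lemma kerr_geodesic_separation:
  fixes \<gamma> :: "real \<Rightarrow> point"
  assumes geo: "is_geodesic (kerr_metric m a) kerr_atlas \<gamma>" "\<gamma> ` {0..1} \<subseteq> kerr_spacetime a"
    and m: "m > 0" and fast: "m\<^sup>2 < a\<^sup>2" and axis: "axial_rotation (\<gamma> 0) = 0"
  obtains E C K t' r' c' where
    "separated_motion m a E C K (\<lambda>s. fst (\<gamma> s)) (\<lambda>s. fst (snd (\<gamma> s))) (\<lambda>s. snd (snd (\<gamma> s)) $ 3) t' r' c'"
proof -
  define \<gamma>' where "\<gamma>' s = vector_derivative \<gamma> (at s within {0..1})" for s
  define t r n where "t s = fst (\<gamma> s)" and "r s = fst (snd (\<gamma> s))" and "n s = snd (snd (\<gamma> s))" for s
  define t' r' n' where "t' s = fst (\<gamma>' s)" and "r' s = fst (snd (\<gamma>' s))" and "n' s = snd (snd (\<gamma>' s))" for s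
  have \<gamma>: "\<gamma> s = (t s, r s, n s)" "\<gamma>' s = (t' s, r' s, n' s)" for s
    by (simp_all add: t_def r_def n_def t'_def r'_def n'_def)
  note laws = kerr_geodesic_laws[OF geo fast, folded \<gamma>'_def]
  have sp: "norm (n s) = 1" "(r s)\<^sup>2 + a\<^sup>2 * (n s $ 3)\<^sup>2 > 0" if "s \<in> {0..1}" for s
    using kerr_spacetimeD[OF subsetD[OF geo(2) imageI[OF that]]] by (simp_all add: n_def r_def)
  have t_deriv: "(t has_real_derivative t' s) (at s within {0..1})"
    and r_deriv: "(r has_real_derivative r' s) (at s within {0..1})"
    and n_deriv: "(n has_vector_derivative n' s) (at s within {0..1})" if "s \<in> {0..1}" for s
    using bounded_linear.has_vector_derivative[OF bounded_linear_fst laws(1)[OF that]]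
      bounded_linear.has_vector_derivative[OF bounded_linear_compose[OF bounded_linear_fst bounded_linear_snd] laws(1)[OF that]]
      bounded_linear.has_vector_derivative[OF bounded_linear_compose[OF bounded_linear_snd bounded_linear_snd] laws(1)[OF that]]
    by (simp_all add: has_real_derivative_iff_has_vector_derivative \<gamma>)
  have c_deriv: "((\<lambda>s. n s $ 3) has_real_derivative n' s $ 3) (at s within {0..1})" if "s \<in> {0..1}" for s
    using bounded_linear.has_vector_derivative[OF bounded_linear_vec_nth n_deriv[OF that]]
    by (simp add: has_real_derivative_iff_has_vector_derivative)
  have nn': "n s \<bullet> n' s = 0" if "s \<in> {0..1}" for s
    by (rule derivative_norm_1[where n=n and n'=n', OF _ that n_deriv[OF that]]) (rule sp)
  define l where "l s = (r s)\<^sup>2 + a\<^sup>2 * (n s $ 3)\<^sup>2" for s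
  define A where "A s = (r s)\<^sup>2 + a\<^sup>2" for s
  define S where "S s = 1 - (n s $ 3)\<^sup>2" for s
  define D where "D s = kerr_Delta m a (r s)" for s
  define b where "b s = 2 * m * r s / l s" for s
  define w where "w s = azimuth_form (n s) (n' s)" for s
  define u where "u s = t' s - a * w s" for s
  have l: "l s > 0" if "s \<in> {0..1}" for s using sp[OF that] by (simp add: l_def)
  have D: "D s > 0" for s using kerr_Delta_pos[OF fast] by (simp add: D_def)
  have a2: "a\<^sup>2 > 0" using fast by (smt (verit) zero_le_power2)
  then have A: "A s > 0" for s by (simp add: A_def add_nonneg_pos)
  have const: "\<exists>k. \<forall>s\<in>{0..1}. f s = k" if "\<And>s. s \<in> {0..1} \<Longrightarrow> (f has_real_derivative 0) (at s within {0..1})" for f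
    using has_field_derivative_zero_constant[of "{0..1}" f] that by auto
  have az0: "azimuth_form v 0 = 0" for v by (simp add: azimuth_form_def)
  obtain E where E0: "\<And>s. s \<in> {0..1} \<Longrightarrow> kerr_metric m a (\<gamma> s) (1, 0, 0) (\<gamma>' s) = - E"
    using const[OF laws(2)] by (metis minus_minus)
  then have E: "t' s - b s * u s = E" if "s \<in> {0..1}" for s
    using E0[OF that] unfolding \<gamma> kerr_metric_dragging_form[OF sp(1)[OF that]] b_def u_def w_def l_def az0
    by simp
  obtain C where C0: "\<And>s. s \<in> {0..1} \<Longrightarrow> kerr_metric m a (\<gamma> s) (\<gamma>' s) (\<gamma>' s) = C"
    using const[OF laws(5)] by metis
  then have C: "C = - (t' s)\<^sup>2 + a\<^sup>2 * (w s)\<^sup>2 + b s * (u s)\<^sup>2 + l s / D s * (r' s)\<^sup>2 + l s * (n' s \<bullet> n' s)"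
    if "s \<in> {0..1}" for s
    using C0[OF that] unfolding \<gamma> kerr_metric_dragging_form[OF sp(1)[OF that]] b_def u_def w_def l_def D_def
    by (simp add: power2_eq_square mult.assoc)
  obtain k where k: "\<And>s. s \<in> {0..1} \<Longrightarrow> kerr_metric m a (\<gamma> s) (axial_rotation (\<gamma> s)) (\<gamma>' s) = k"
    using const[OF laws(3)] by metis
  \<comment> \<open>The conserved angular momentum is evaluated at the start, where the Killing
    field vanishes.\<close>
  have "kerr_metric m a (\<gamma> 0) (axial_rotation (\<gamma> 0)) (\<gamma>' 0) = 0"
    unfolding axis using bilinear_lzero[OF bilinear_kerr_metric] .
  then have "k = 0" using k[of 0] by simp
  have L: "A s * w s = a * b s * S s * u s" if s: "s \<in> {0..1}" for s
  proof -
    have "n s \<bullet> n s = 1" using sp(1)[OF s] by (simp add: norm_eq_1)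
    then have n: "(n s $ 1)\<^sup>2 + (n s $ 2)\<^sup>2 = S s"
      by (simp add: S_def inner_vec_def sum_3 power2_eq_square)
    have az: "azimuth_form (n s) (vector [- (n s $ 2), n s $ 1, 0]) = S s"
      unfolding n[symmetric] by (simp add: azimuth_form_def power2_eq_square)
    have inner: "vector [- (n s $ 2), n s $ 1, 0] \<bullet> n' s = w s"
      by (simp add: w_def azimuth_form_def inner_vec_def sum_3)
    have "a\<^sup>2 * S s * w s + b s * (- a * S s) * u s + l s * w s = 0"
      using k[OF s] unfolding \<open>k = 0\<close> \<gamma> axial_rotation_def snd_conv kerr_metric_dragging_form[OF sp(1)[OF s]]
        az inner b_def u_def w_def l_def by simp
    moreover have "A s = l s + a\<^sup>2 * S s" by (simp add: A_def l_def S_def algebra_simps)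
    ultimately show ?thesis by algebra
  qed
  have id: "l s * t' s = E * (l s + 2 * m * r s * A s / D s)"
    "(l s * n' s $ 3)\<^sup>2 = S s * ((E\<^sup>2 * (A s)\<^sup>2 - (l s * r' s)\<^sup>2) / D s + C * (r s)\<^sup>2 - a\<^sup>2 * E\<^sup>2 * S s + a\<^sup>2 * C * (1 - S s))"
    "l s * (2 * (r s - m) * r' s * (l s / D s * r' s) + D s * ((2 * m * (l s - 2 * (r s)\<^sup>2) / (l s)\<^sup>2 * (u s)\<^sup>2
            + (2 * r s / D s - 2 * (r s - m) * l s / (D s)\<^sup>2) * (r' s)\<^sup>2 + 2 * r s * (n' s \<bullet> n' s)) / 2))
        = 2 * E\<^sup>2 * r s * A s - (r s - m) * ((E\<^sup>2 * (A s)\<^sup>2 - (l s * r' s)\<^sup>2) / D s) + C * r s * D s"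
    if s: "s \<in> {0..1}" for s
  proof -
    have bl: "b s * l s = 2 * m * r s" using l[OF s] by (simp add: b_def)
    have 1: "A s = (r s)\<^sup>2 + a\<^sup>2" "l s = A s - a\<^sup>2 * S s" "D s = A s - 2 * m * r s" "u s = t' s - a * w s"
      by (simp_all add: A_def l_def S_def D_def u_def kerr_Delta_def algebra_simps)
    have 2: "S s * (n' s \<bullet> n' s) = (n' s $ 3)\<^sup>2 + (w s)\<^sup>2"
      unfolding S_def w_def using sp(1)[OF s] nn'[OF s] by (intro sphere_tangent_identity) (simp_all add: norm_eq_1)
    note id = separation_identities[OF 1(1-3) bl l[OF s] D A 1(4) E[OF s] L[OF s] C[OF s] 2]
    show "l s * t' s = E * (l s + 2 * m * r s * A s / D s)" by (rule id(1))
    show "(l s * n' s $ 3)\<^sup>2 = S s * ((E\<^sup>2 * (A s)\<^sup>2 - (l s * r' s)\<^sup>2) / D s + C * (r s)\<^sup>2 - a\<^sup>2 * E\<^sup>2 * S s + a\<^sup>2 * C * (1 - S s))"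
      by (rule id(2))
    show "l s * (2 * (r s - m) * r' s * (l s / D s * r' s) + D s * ((2 * m * (l s - 2 * (r s)\<^sup>2) / (l s)\<^sup>2 * (u s)\<^sup>2
            + (2 * r s / D s - 2 * (r s - m) * l s / (D s)\<^sup>2) * (r' s)\<^sup>2 + 2 * r s * (n' s \<bullet> n' s)) / 2))
        = 2 * E\<^sup>2 * r s * A s - (r s - m) * ((E\<^sup>2 * (A s)\<^sup>2 - (l s * r' s)\<^sup>2) / D s) + C * r s * D s"
      by (rule id(3))
  qed
  define y where "y s = l s * r' s" for s
  \<comment> \<open>This is the radial equation solved for K - C r^2. Carter's constant is obtained
    by showing that Q + C r^2 has zero derivative.\<close>
  define Q where "Q s = (E\<^sup>2 * (A s)\<^sup>2 - (y s)\<^sup>2) / D s" for s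
  define y' where "y' s = (2 * E\<^sup>2 * r s * A s - (r s - m) * Q s + C * r s * D s) / l s" for s
  have D_deriv: "(D has_real_derivative 2 * (r s - m) * r' s) (at s within {0..1})" if "s \<in> {0..1}" for s
    unfolding D_def kerr_Delta_def by (auto intro!: derivative_eq_intros r_deriv[OF that] simp: algebra_simps)
  have y_deriv: "(y has_real_derivative y' s) (at s within {0..1})" if s: "s \<in> {0..1}" for s
  proof -
    define X where "X = 2 * m * (l s - 2 * (r s)\<^sup>2) / (l s)\<^sup>2 * (u s)\<^sup>2
            + (2 * r s / D s - 2 * (r s - m) * l s / (D s)\<^sup>2) * (r' s)\<^sup>2 + 2 * r s * (n' s \<bullet> n' s)"
    have "kerr_metric_dr m a (\<gamma> s) (\<gamma>' s) (\<gamma>' s) = X"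
      unfolding \<gamma> kerr_metric_dr.simps Let_def X_def D_def u_def w_def l_def power2_eq_square[of "t' s - _"]
        power2_eq_square[of "r' s"] mult.assoc by (rule refl)
    moreover have "kerr_metric m a (\<gamma> s) (0, 1, 0) (\<gamma>' s) = l s / D s * r' s" if "s \<in> {0..1}" for s
      unfolding \<gamma> kerr_metric_dragging_form[OF sp(1)[OF that]] l_def D_def by (simp add: azimuth_form_def)
    ultimately have P: "((\<lambda>s. l s / D s * r' s) has_real_derivative X / 2) (at s within {0..1})"
      using has_field_derivative_transform_within[OF laws(4)[OF s] zero_less_one s, of "\<lambda>s. l s / D s * r' s"] by simp
    \<comment> \<open>\<lambda> r' is \<triangle> times the radial momentum, whose derivative is
      supplied by the radial law.\<close>
    have "y = (\<lambda>s. D s * (l s / D s * r' s))"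
      using D by (simp add: fun_eq_iff y_def less_imp_neq[symmetric])
    then have "(y has_real_derivative 2 * (r s - m) * r' s * (l s / D s * r' s) + X / 2 * D s) (at s within {0..1})"
      using DERIV_mult[OF D_deriv[OF s] P] by simp
    moreover have "2 * (r s - m) * r' s * (l s / D s * r' s) + X / 2 * D s = y' s"
    proof -
      have "l s * (2 * (r s - m) * r' s * (l s / D s * r' s) + X / 2 * D s) =
          2 * E\<^sup>2 * r s * A s - (r s - m) * Q s + C * r s * D s"
        using id(3)[OF s] unfolding X_def[symmetric] Q_def y_def by (simp only: mult.commute[of "X / 2"])
      then show ?thesis
        unfolding y'_def using l[OF s] by (metis less_irrefl nonzero_mult_div_cancel_left)
    qed
    ultimately show ?thesis by simp
  qed
  have "((\<lambda>s. Q s + C * (r s)\<^sup>2) has_real_derivative 0) (at s within {0..1})" if s: "s \<in> {0..1}" for s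
  proof -
    have "(A has_real_derivative 2 * r s * r' s) (at s within {0..1})"
      unfolding A_def by (auto intro!: derivative_eq_intros r_deriv[OF s])
    then have num: "((\<lambda>s. E\<^sup>2 * (A s)\<^sup>2 - (y s)\<^sup>2) has_real_derivative 4 * E\<^sup>2 * A s * r s * r' s - 2 * y s * y' s) (at s within {0..1})"
      by (auto intro!: derivative_eq_intros y_deriv[OF s])
    have "(Q has_real_derivative ((4 * E\<^sup>2 * A s * r s * r' s - 2 * y s * y' s) * D s
        - (E\<^sup>2 * (A s)\<^sup>2 - (y s)\<^sup>2) * (2 * (r s - m) * r' s)) / (D s * D s)) (at s within {0..1})"
      unfolding Q_def using D[of s] by (intro DERIV_divide num D_deriv s) simp
    moreover have "((\<lambda>s. C * (r s)\<^sup>2) has_real_derivative 2 * C * r s * r' s) (at s within {0..1})"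
      by (auto intro!: derivative_eq_intros r_deriv[OF s])
    ultimately have "((\<lambda>s. Q s + C * (r s)\<^sup>2) has_real_derivative ((4 * E\<^sup>2 * A s * r s * r' s - 2 * y s * y' s) * D s
        - (E\<^sup>2 * (A s)\<^sup>2 - (y s)\<^sup>2) * (2 * (r s - m) * r' s)) / (D s * D s) + 2 * C * r s * r' s) (at s within {0..1})"
      by (rule DERIV_add)
    moreover have "((4 * E\<^sup>2 * A s * r s * r' s - 2 * y s * y' s) * D s
        - (E\<^sup>2 * (A s)\<^sup>2 - (y s)\<^sup>2) * (2 * (r s - m) * r' s)) / (D s * D s) + 2 * C * r s * r' s = 0"
    proof -
      have Q: "Q s * D s = E\<^sup>2 * (A s)\<^sup>2 - (y s)\<^sup>2" using D[of s] by (simp add: Q_def)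
      have "y' s * l s = 2 * E\<^sup>2 * r s * A s - (r s - m) * Q s + C * r s * D s"
        using l[OF s] by (simp add: y'_def)
      then have "(4 * E\<^sup>2 * A s * r s * r' s - 2 * y s * y' s) * D s
        - (E\<^sup>2 * (A s)\<^sup>2 - (y s)\<^sup>2) * (2 * (r s - m) * r' s) = - (2 * C * r s * r' s) * (D s * D s)"
        using Q y_def[of s] by algebra
      then show ?thesis using D[of s] by simp
    qed
    ultimately show ?thesis by simp
  qed
  from const[OF this] obtain K where "\<forall>s\<in>{0..1}. Q s + C * (r s)\<^sup>2 = K" ..
  then have K: "Q s = K - C * (r s)\<^sup>2" if "s \<in> {0..1}" for s
    using that by (simp add: eq_diff_eq)
  have "separated_motion m a E C K t r (\<lambda>s. n s $ 3) t' r' (\<lambda>s. n' s $ 3)"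
  proof
    show "m > 0" "m\<^sup>2 < a\<^sup>2" by fact+
    fix s :: real assume s: "s \<in> {0..1}"
    show "(t has_real_derivative t' s) (at s within {0..1})" "(r has_real_derivative r' s) (at s within {0..1})"
      "((\<lambda>s. n s $ 3) has_real_derivative n' s $ 3) (at s within {0..1})"
      "0 < (r s)\<^sup>2 + a\<^sup>2 * (n s $ 3)\<^sup>2"
      using t_deriv r_deriv c_deriv sp(2) s by blast+
    show "(n s $ 3)\<^sup>2 \<le> 1"
      using component_le_norm_cart[of "n s" 3] sp(1)[OF s] by (simp add: abs_square_le_1)
    show "((r s)\<^sup>2 + a\<^sup>2 * (n s $ 3)\<^sup>2) * t' s =
        E * ((r s)\<^sup>2 + a\<^sup>2 * (n s $ 3)\<^sup>2 + 2 * m * r s * ((r s)\<^sup>2 + a\<^sup>2) / kerr_Delta m a (r s))"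
      using id(1)[OF s] by (simp only: l_def A_def D_def)
    have "(y s)\<^sup>2 = E\<^sup>2 * (A s)\<^sup>2 - D s * Q s" using D[of s] by (simp add: Q_def)
    then show "(((r s)\<^sup>2 + a\<^sup>2 * (n s $ 3)\<^sup>2) * r' s)\<^sup>2 =
        E\<^sup>2 * ((r s)\<^sup>2 + a\<^sup>2)\<^sup>2 - kerr_Delta m a (r s) * (K - C * (r s)\<^sup>2)"
      unfolding K[OF s] by (simp only: y_def l_def A_def D_def)
    have "(l s * n' s $ 3)\<^sup>2 = S s * (K - a\<^sup>2 * E\<^sup>2 * S s + a\<^sup>2 * C * (1 - S s))"
      using id(2)[OF s] K[OF s] by (simp add: Q_def y_def)
    then show "(((r s)\<^sup>2 + a\<^sup>2 * (n s $ 3)\<^sup>2) * n' s $ 3)\<^sup>2 =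
        (1 - (n s $ 3)\<^sup>2) * (K - a\<^sup>2 * E\<^sup>2 * (1 - (n s $ 3)\<^sup>2) + a\<^sup>2 * C * (n s $ 3)\<^sup>2)"
      by (simp add: l_def S_def)
    show "((\<lambda>s. ((r s)\<^sup>2 + a\<^sup>2 * (n s $ 3)\<^sup>2) * r' s) has_real_derivative
          (2 * E\<^sup>2 * r s * ((r s)\<^sup>2 + a\<^sup>2) - (r s - m) * (K - C * (r s)\<^sup>2)
             + C * r s * kerr_Delta m a (r s)) / ((r s)\<^sup>2 + a\<^sup>2 * (n s $ 3)\<^sup>2)) (at s within {0..1})"
      using y_deriv[OF s] unfolding y'_def K[OF s] unfolding y_def[abs_def] l_def A_def D_def .
  qed
  then show thesis
    using that unfolding t_def[abs_def] r_def[abs_def] n_def[abs_def] by blast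
qed

section \<open>Non-connectedness\<close>

text \<open>Reduces each claim to the separated system. That system sees only t, r and c, so
  membership of the curve in \<open>D\<close> is passed on as the existence of a point of
  \<open>D\<close> with the same r and c.\<close>

lemma no_kerr_geodesic_between_poles:
  assumes "D \<subseteq> kerr_spacetime a" "p \<in> D" "q \<in> D" "snd (snd p) = axis 3 1" "snd (snd q) = - axis 3 1"
    and m: "m > 0" and fast: "m\<^sup>2 < a\<^sup>2"
    and no: "\<And>E C K t r c t' r' c'. separated_motion m a E C K t r c t' r' c' \<Longrightarrow>
       (\<And>s. s \<in> {0..1} \<Longrightarrow> \<exists>x\<in>D. r s = fst (snd x) \<and> c s = snd (snd x) $ 3) \<Longrightarrow>
       t 0 = fst p \<Longrightarrow> t 1 = fst q \<Longrightarrow> r 0 = fst (snd p) \<Longrightarrow> r 1 = fst (snd q) \<Longrightarrow> c 0 = 1 \<Longrightarrow> c 1 = -1 \<Longrightarrow> False"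
  shows "\<not> kerr_geodesically_connected m a D"
proof
  assume "kerr_geodesically_connected m a D"
  then obtain \<gamma> where \<gamma>: "is_geodesic (kerr_metric m a) kerr_atlas \<gamma>" "\<gamma> ` {0..1} \<subseteq> D" "\<gamma> 0 = p" "\<gamma> 1 = q"
    using assms(2,3) unfolding geodesically_connected_def by blast
  have "axial_rotation (\<gamma> 0) = 0"
    by (simp add: \<gamma>(3) axial_rotation_def assms(4) axis_def vec_eq_iff forall_3 zero_prod_def)
  then obtain E C K t' r' c' where
    "separated_motion m a E C K (\<lambda>s. fst (\<gamma> s)) (\<lambda>s. fst (snd (\<gamma> s))) (\<lambda>s. snd (snd (\<gamma> s)) $ 3) t' r' c'"
    using kerr_geodesic_separation[OF \<gamma>(1) _ m fast] \<gamma>(2) assms(1) by blast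
  then show False
  proof (rule no)
    show "\<exists>x\<in>D. fst (snd (\<gamma> s)) = fst (snd x) \<and> snd (snd (\<gamma> s)) $ 3 = snd (snd x) $ 3" if "s \<in> {0..1}" for s
      using \<gamma>(2) that by blast
  qed (use \<gamma>(3,4) assms(4,5) in \<open>auto simp: axis_def\<close>)
qed

text \<open>On the axis \<lambda> = r^2 + a^2, hence \<beta> = \<triangle>/\<lambda> > 0. In the
  fast case the whole axis is therefore nonsingular and stationary, for every real r.\<close>

lemma kerr_pole_mem:
  assumes "m\<^sup>2 < a\<^sup>2" "\<sigma> = 1 \<or> \<sigma> = -1"
  shows "(t, r, \<sigma> *\<^sub>R axis 3 1) \<in> kerr_spacetime a" "(t, r, \<sigma> *\<^sub>R axis 3 1) \<in> kerr_stationary m a"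
proof -
  let ?n = "\<sigma> *\<^sub>R axis 3 1 :: real^3"
  have n: "norm ?n = 1" using assms(2) by auto
  have "a\<^sup>2 > 0" using assms(1) by (smt (verit) zero_le_power2)
  then have "a \<noteq> 0" and A: "r\<^sup>2 + a\<^sup>2 > 0" by (auto simp: add_nonneg_pos)
  have "(cos (colatitude ?n))\<^sup>2 = 1"
    unfolding cos_colatitude[OF n] using assms(2) by (auto simp: axis_def)
  then have l: "kerr_lambda a r (colatitude ?n) = r\<^sup>2 + a\<^sup>2" by (simp add: kerr_lambda_def)
  then show 1: "(t, r, ?n) \<in> kerr_spacetime a" using n \<open>a \<noteq> 0\<close> by (simp add: kerr_spacetime_def)
  have "2 * m * r < r\<^sup>2 + a\<^sup>2" using kerr_Delta_pos[OF assms(1), of r] by (simp add: kerr_Delta_def)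
  then have "kerr_beta m a r (colatitude ?n) > 0" using A by (simp add: kerr_beta_def l)
  then show "(t, r, ?n) \<in> kerr_stationary m a" using 1 by (simp add: kerr_stationary_def)
qed

text \<open>Covers the stationary part with real r and the whole spacetime together: poles with r =
  1 and r = -1 lie in both, and the obstruction does not depend on the region.\<close>

lemma not_connected_through_ring:
  assumes "m > 0" "m\<^sup>2 < a\<^sup>2" "D \<subseteq> kerr_spacetime a" "kerr_stationary m a \<subseteq> D"
  shows "\<not> kerr_geodesically_connected m a D"
proof (rule no_kerr_geodesic_between_poles[of D a "(0, 1, axis 3 1)" "(0, -1, - axis 3 1)"])
  show "(0, 1, axis 3 1) \<in> D" "(0, -1, - axis 3 1) \<in> D"
    using kerr_pole_mem(2)[OF assms(2), of 1 0 1] kerr_pole_mem(2)[OF assms(2), of "-1" 0 "-1"] assms(4) by auto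
  fix E C K t r c t' r' c'
  assume "separated_motion m a E C K t r c t' r' c'"
  then interpret separated_motion m a E C K t r c t' r' c' .
  assume "r 0 = fst (snd (0::real, 1::real, axis 3 1 :: real^3))" "r 1 = fst (snd (0::real, -1::real, - axis 3 1 :: real^3))"
    "c 0 = 1" "c 1 = -1"
  then show False using no_ring_passage by simp
qed (use assms in auto)

lemma not_connected_stationary_above:
  assumes "m > 0" "m\<^sup>2 < a\<^sup>2"
  shows "\<not> kerr_geodesically_connected m a (kerr_stationary m a \<inter> kerr_region_above a 0)"
    (is "\<not> kerr_geodesically_connected m a ?D")
proof (rule no_kerr_geodesic_between_poles[of ?D a "(0, m, axis 3 1)" "(0, m, - axis 3 1)"])
  show "?D \<subseteq> kerr_spacetime a" by (auto simp: kerr_stationary_def)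
  show "(0, m, axis 3 1) \<in> ?D" "(0, m, - axis 3 1) \<in> ?D"
    using kerr_pole_mem[OF assms(2), of 1 0 m] kerr_pole_mem[OF assms(2), of "-1" 0 m] assms(1)
    by (auto simp: kerr_region_above_def)
  fix E C K t r c t' r' c'
  assume "separated_motion m a E C K t r c t' r' c'"
  then interpret separated_motion m a E C K t r c t' r' c' .
  assume D: "\<And>s. s \<in> {0..1} \<Longrightarrow> \<exists>x\<in>?D. r s = fst (snd x) \<and> c s = snd (snd x) $ 3"
    and ends: "t 0 = fst (0::real, m, axis 3 1 :: real^3)" "t 1 = fst (0::real, m, - axis 3 1 :: real^3)"
    "r 0 = fst (snd (0::real, m, axis 3 1 :: real^3))" "r 1 = fst (snd (0::real, m, - axis 3 1 :: real^3))"
    "c 0 = 1" "c 1 = -1"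
  have "r s > 0" if "s \<in> {0..1}" for s
    using D[OF that] by (auto simp: kerr_region_above_def)
  then have E: "E = 0" using energy_zero ends by simp
  obtain s where s: "0 < s" "s < 1" "c s = 0" using equator_crossing ends(5,6) by metis
  then have s01: "s \<in> {0..1}" by simp
  obtain t0 n where x: "(t0, r s, n) \<in> ?D" "n $ 3 = 0"
    using D[OF s01] s(3) by auto
  then have r: "r s > 0" and n: "norm n = 1" and \<beta>: "kerr_beta m a (r s) (colatitude n) > 0"
    by (auto simp: kerr_region_above_def kerr_stationary_def kerr_spacetime_def)
  have "kerr_lambda a (r s) (colatitude n) = (r s)\<^sup>2"
    using cos_colatitude[OF n] x(2) by (simp add: kerr_lambda_def)
  \<comment> \<open>On the equator \<lambda> = r^2, so \<beta> > 0 with r > 0 means r > 2m. The end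
    points have radius m, which bounds r along the curve; any positive end radius up to 2m would
    lead to the same contradiction.\<close>
  then have "r s > 2 * m" using \<beta> r by (simp add: kerr_beta_def power2_eq_square field_simps)
  moreover have "r s \<le> m"
    using zero_energy_r_le[OF E ends(5,6) _ _ _ s01, of m] ends assms(1) by simp
  ultimately show False using assms(1) by simp
qed (use assms in auto)

lemma not_connected_above:
  assumes "m > 0" "m\<^sup>2 < a\<^sup>2" "\<nu> > 0"
  shows "\<not> kerr_geodesically_connected m a (kerr_region_above a \<nu>)"
    (is "\<not> kerr_geodesically_connected m a ?D")
proof -
  define \<kappa> where "\<kappa> = \<nu> * (a\<^sup>2 - m\<^sup>2) / 2"
  define B where "B = (\<nu> + 1)\<^sup>2 + a\<^sup>2"
  \<comment> \<open>\<delta> is the value of r0^2 - \<nu>^2. The three bounds ensure in turn r0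
    \<le> \<nu> + 1 and the two smallness conditions of \<open>zero_energy_long_return\<close>; the
    factor 2 in the last one makes the inequality strict.\<close>
  define \<delta> where "\<delta> = min 1 (min (\<kappa> / m) (\<kappa>\<^sup>2 / (2 * B\<^sup>2)))"
  define r0 where "r0 = sqrt (\<nu>\<^sup>2 + \<delta>)"
  have \<kappa>: "\<kappa> > 0" using assms by (simp add: \<kappa>_def)
  have B: "B > 0" using assms(3) by (simp add: B_def add_pos_nonneg)
  have \<delta>: "\<delta> > 0" using \<kappa> B assms(1) by (simp add: \<delta>_def)
  have r0_sq: "r0\<^sup>2 - \<nu>\<^sup>2 = \<delta>" using \<delta> by (simp add: r0_def)
  have r0: "\<nu> < r0" unfolding r0_def using \<delta> assms(3) by (intro real_less_rsqrt) simp
  have "\<delta> \<le> 1" by (simp add: \<delta>_def)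
  then have "\<nu>\<^sup>2 + \<delta> \<le> (\<nu> + 1)\<^sup>2" using assms(3) by (simp add: power2_sum)
  then have r0_le: "r0 \<le> \<nu> + 1" unfolding r0_def using assms(3) by (intro real_le_lsqrt) auto
  have "\<delta> \<le> \<kappa> / m" by (simp add: \<delta>_def)
  then have m\<delta>: "m * (r0\<^sup>2 - \<nu>\<^sup>2) \<le> \<kappa>" unfolding r0_sq using assms(1) by (simp add: field_simps)
  have "\<delta> \<le> \<kappa>\<^sup>2 / (2 * B\<^sup>2)" by (simp add: \<delta>_def)
  then have "B\<^sup>2 * \<delta> \<le> \<kappa>\<^sup>2 / 2" using B by (simp add: field_simps)
  then have B\<delta>: "B\<^sup>2 * (r0\<^sup>2 - \<nu>\<^sup>2) < \<kappa>\<^sup>2" unfolding r0_sq using zero_less_power[OF \<kappa>, of 2] by linarith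
  show ?thesis
  proof (rule no_kerr_geodesic_between_poles[of ?D a "(0, r0, axis 3 1)" "(0, r0, - axis 3 1)"])
    show "?D \<subseteq> kerr_spacetime a" by (auto simp: kerr_region_above_def)
    show "(0, r0, axis 3 1) \<in> ?D" "(0, r0, - axis 3 1) \<in> ?D"
      using kerr_pole_mem(1)[OF assms(2), of 1 0 r0] kerr_pole_mem(1)[OF assms(2), of "-1" 0 r0] r0
      by (auto simp: kerr_region_above_def)
    fix E C K t r c t' r' c'
    assume "separated_motion m a E C K t r c t' r' c'"
    then interpret separated_motion m a E C K t r c t' r' c' .
    assume D: "\<And>s. s \<in> {0..1} \<Longrightarrow> \<exists>x\<in>?D. r s = fst (snd x) \<and> c s = snd (snd x) $ 3"
      and ends: "t 0 = fst (0::real, r0, axis 3 1 :: real^3)" "t 1 = fst (0::real, r0, - axis 3 1 :: real^3)"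
      "r 0 = fst (snd (0::real, r0, axis 3 1 :: real^3))" "r 1 = fst (snd (0::real, r0, - axis 3 1 :: real^3))"
      "c 0 = 1" "c 1 = -1"
    have r: "r s > \<nu>" if "s \<in> {0..1}" for s
      using D[OF that] by (auto simp: kerr_region_above_def)
    then have "E = 0" using energy_zero ends assms(3) by fastforce
    then show False
      using zero_energy_long_return[OF _ ends(5,6) _ _ assms(3) r0_le] m\<delta> B\<delta> r ends
      unfolding \<kappa>_def B_def by simp
  qed (use assms in auto)
qed

theorem theorem5:
  fixes m a :: real
  assumes "m > 0" and "a\<^sup>2 > m\<^sup>2"
  shows "(\<not> kerr_geodesically_connected m a (kerr_stationary m a \<inter> kerr_region_above a 0) \<and>
          \<not> kerr_geodesically_connected m a (kerr_stationary m a)) \<and>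
         (\<forall>\<nu>>0. \<not> kerr_geodesically_connected m a (kerr_region_above a \<nu>)) \<and>
         \<not> kerr_geodesically_connected m a (kerr_spacetime a)"
proof (intro conjI allI impI)
  show "\<not> kerr_geodesically_connected m a (kerr_stationary m a \<inter> kerr_region_above a 0)"
    using assms by (rule not_connected_stationary_above)
  show "\<not> kerr_geodesically_connected m a (kerr_region_above a \<nu>)" if "\<nu> > 0" for \<nu>
    using assms that by (rule not_connected_above)
  have "kerr_stationary m a \<subseteq> kerr_spacetime a" by (auto simp: kerr_stationary_def)
  then show "\<not> kerr_geodesically_connected m a (kerr_stationary m a)"
    "\<not> kerr_geodesically_connected m a (kerr_spacetime a)"
    using not_connected_through_ring[OF assms] by blast+
qed

end
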